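(* Let $k\ge1$. The set $P$ of primitive elements of the free group $\mathbf{F}_k$ is closed in the profinite topology on $\mathbf{F}_k$.
   Context: An element of the free group $\mathbf{F}_k$ of rank $k$ is primitive if it belongs to some basis (free generating set) of $\mathbf{F}_k$. The profinite topology on $\mathbf{F}_k$ is the topology whose basis of open sets consists of all cosets of finite index subgroups of $\mathbf{F}_k$. *)

theory Defs
  imports "HOL-Analysis.Abstract_Topology" "HOL-Algebra.Generated_Groups" "HOL-Algebra.Bij"
begin

section \<open>Free bases\<close>

text \<open>A word is a list of signed letters; \<open>(x, True)\<close> stands for \<open>x\<close> and
  \<open>(x, False)\<close> for the formal inverse of \<open>x\<close>.\<close>

type_synonym 'a word = "('a \<times> bool) list"

definition cancels :: "'a \<times> bool \<Rightarrow> 'a \<times> bool \<Rightarrow> bool" where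
  "cancels p q \<longleftrightarrow> fst p = fst q \<and> snd p \<noteq> snd q"

definition reduced :: "'a word \<Rightarrow> bool" where
  "reduced w \<longleftrightarrow> successively (\<lambda>p q. \<not> cancels p q) w"

definition letter_eval :: "('a, 'm) monoid_scheme \<Rightarrow> 'a \<times> bool \<Rightarrow> 'a" where
  "letter_eval G p = (if snd p then fst p else inv\<^bsub>G\<^esub> (fst p))"

definition word_eval :: "('a, 'm) monoid_scheme \<Rightarrow> 'a word \<Rightarrow> 'a" where
  "word_eval G w = foldr (\<lambda>p g. letter_eval G p \<otimes>\<^bsub>G\<^esub> g) w \<one>\<^bsub>G\<^esub>"

text \<open>A free generating set: it generates the group and its elements satisfy no
  nontrivial relation.\<close>

definition free_basis :: "('a, 'm) monoid_scheme \<Rightarrow> 'a set \<Rightarrow> bool" where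
  "free_basis G B \<longleftrightarrow>
     B \<subseteq> carrier G \<and> generate G B = carrier G \<and>
     (\<forall>w. reduced w \<and> fst ` set w \<subseteq> B \<and> w \<noteq> [] \<longrightarrow> word_eval G w \<noteq> \<one>\<^bsub>G\<^esub>)"

text \<open>\<open>\<^bold>F\<^sub>k\<close> is only determined up to isomorphism, so we speak about an arbitrary
  group having a free basis of \<open>k\<close> elements; existence is
  \<open>ex_free_group_of_rank\<close> below.\<close>

definition free_group_of_rank :: "('a, 'm) monoid_scheme \<Rightarrow> nat \<Rightarrow> bool" where
  "free_group_of_rank G k \<longleftrightarrow>
     group G \<and> (\<exists>X. finite X \<and> card X = k \<and> free_basis G X)"

definition primitive :: "('a, 'm) monoid_scheme \<Rightarrow> 'a \<Rightarrow> bool" where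
  "primitive G g \<longleftrightarrow> (\<exists>B. free_basis G B \<and> g \<in> B)"


section \<open>The profinite topology\<close>

definition finite_index_subgroup :: "'a set \<Rightarrow> ('a, 'm) monoid_scheme \<Rightarrow> bool" where
  "finite_index_subgroup H G \<longleftrightarrow> subgroup H G \<and> finite (rcosets\<^bsub>G\<^esub> H)"

text \<open>Right cosets suffice: the left coset \<open>xH\<close> is a right coset of the subgroup
  \<open>xHx\<inverse>\<close>, which has the same index.\<close>

definition finite_index_cosets :: "('a, 'm) monoid_scheme \<Rightarrow> 'a set set" where
  "finite_index_cosets G = {C. \<exists>H. finite_index_subgroup H G \<and> C \<in> rcosets\<^bsub>G\<^esub> H}"

text \<open>\<^const>\<open>topology_generated_by\<close> takes a subbasis; by
  \<open>openin_profinite_topology\<close> below the cosets are in fact a basis.\<close>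

definition profinite_topology :: "('a, 'm) monoid_scheme \<Rightarrow> 'a topology" where
  "profinite_topology G = topology_generated_by (finite_index_cosets G)"

lemma (in group) finite_index_subgroup_Int:
  assumes "finite_index_subgroup H G" "finite_index_subgroup K G"
  shows "finite_index_subgroup (H \<inter> K) G"
proof -
  have H: "subgroup H G" "finite (rcosets H)" and K: "subgroup K G" "finite (rcosets K)"
    using assms by (auto simp: finite_index_subgroup_def)
  have "(H \<inter> K) #> x = (H #> x) \<inter> (K #> x)" if x: "x \<in> carrier G" for x
    using x subgroup.mem_carrier[OF H(1)] subgroup.mem_carrier[OF K(1)]
    by (auto simp: r_coset_def)
  then have "C \<in> (\<lambda>(A, B). A \<inter> B) ` ((rcosets H) \<times> (rcosets K))" if "C \<in> rcosets (H \<inter> K)" for C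
    using that by (fastforce simp: RCOSETS_def)
  then have "rcosets (H \<inter> K) \<subseteq> (\<lambda>(A, B). A \<inter> B) ` ((rcosets H) \<times> (rcosets K))"
    by blast
  then have "finite (rcosets (H \<inter> K))"
    by (rule finite_subset) (use H K in auto)
  with H K show ?thesis
    by (simp add: finite_index_subgroup_def subgroups_Inter_pair)
qed

lemma (in group) finite_index_coset_subset_carrier:
  assumes "C \<in> finite_index_cosets G"
  shows "C \<subseteq> carrier G"
  using assms rcosets_part_G
  by (fastforce simp: finite_index_cosets_def finite_index_subgroup_def)

lemma (in group) finite_index_coset_repr:
  assumes "C \<in> finite_index_cosets G" "x \<in> C"
  obtains H where "finite_index_subgroup H G" "C = H #> x"
proof -
  obtain H y where H: "finite_index_subgroup H G" and y: "y \<in> carrier G" "C = H #> y"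
    using assms(1) by (auto simp: finite_index_cosets_def RCOSETS_def)
  then have "C = H #> x"
    using repr_independence[of x H y] assms(2) by (simp add: finite_index_subgroup_def)
  with H show ?thesis by (rule that)
qed

lemma (in group) openin_profinite_topology:
  "openin (profinite_topology G) U \<longleftrightarrow> (\<exists>\<B>. \<B> \<subseteq> finite_index_cosets G \<and> U = \<Union>\<B>)"
proof
  assume "\<exists>\<B>. \<B> \<subseteq> finite_index_cosets G \<and> U = \<Union>\<B>"
  then show "openin (profinite_topology G) U"
    unfolding profinite_topology_def by (blast intro: openin_Union topology_generated_by_Basis)
next
  assume "openin (profinite_topology G) U"
  then have "generate_topology_on (finite_index_cosets G) U"
    by (simp add: profinite_topology_def openin_topology_generated_by_iff)
  then have "\<forall>x\<in>U. \<exists>C\<in>finite_index_cosets G. x \<in> C \<and> C \<subseteq> U"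
  proof induction
    case (Int a b)
    show ?case
    proof
      fix x assume x: "x \<in> a \<inter> b"
      from Int x obtain C D where CD: "C \<in> finite_index_cosets G" "x \<in> C" "C \<subseteq> a"
        "D \<in> finite_index_cosets G" "x \<in> D" "D \<subseteq> b" by blast
      obtain H where H: "finite_index_subgroup H G" "C = H #> x"
        using CD finite_index_coset_repr by metis
      obtain K where K: "finite_index_subgroup K G" "D = K #> x"
        using CD finite_index_coset_repr by metis
      have x': "x \<in> carrier G"
        using CD finite_index_coset_subset_carrier by blast
      have HK: "finite_index_subgroup (H \<inter> K) G"
        using H K by (simp add: finite_index_subgroup_Int)
      then have "(H \<inter> K) #> x \<in> finite_index_cosets G"
        using x' by (auto simp: finite_index_cosets_def RCOSETS_def)
      moreover have "x \<in> (H \<inter> K) #> x"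
        using HK x' rcos_self by (simp add: finite_index_subgroup_def)
      moreover have "(H \<inter> K) #> x \<subseteq> a \<inter> b"
        using CD H K by (auto simp: r_coset_def)
      ultimately show "\<exists>C\<in>finite_index_cosets G. x \<in> C \<and> C \<subseteq> a \<inter> b" by blast
    qed
  next
    case (UN K)
    then show ?case by (meson Union_iff Union_upper subset_trans)
  qed auto
  then have "U = \<Union>{C \<in> finite_index_cosets G. C \<subseteq> U}" by blast
  then show "\<exists>\<B>. \<B> \<subseteq> finite_index_cosets G \<and> U = \<Union>\<B>"
    by (intro exI[of _ "{C \<in> finite_index_cosets G. C \<subseteq> U}"] conjI) auto
qed

lemma (in group) topspace_profinite_topology: "topspace (profinite_topology G) = carrier G"
proof -
  have "rcosets (carrier G) = {carrier G}"
    using coset_join2 subgroup_self one_closed by (auto simp: RCOSETS_def)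
  then have "carrier G \<in> finite_index_cosets G"
    using subgroup_self by (auto simp: finite_index_cosets_def finite_index_subgroup_def)
  then show ?thesis
    using finite_index_coset_subset_carrier by (auto simp: profinite_topology_def)
qed


section \<open>Existence of free groups\<close>

text \<open>Each letter acts on the reduced words over \<open>{..<k}\<close> by left multiplication
  followed by cancellation; the permutations obtained freely generate their group.\<close>

definition letter_act :: "'a \<times> bool \<Rightarrow> 'a word \<Rightarrow> 'a word" where
  "letter_act p w = (if w \<noteq> [] \<and> cancels p (hd w) then tl w else p # w)"

definition reduced_words :: "'a set \<Rightarrow> 'a word set" where
  "reduced_words A = {w. reduced w \<and> fst ` set w \<subseteq> A}"

lemma reduced_Cons: "reduced (p # w) \<longleftrightarrow> reduced w \<and> (w \<noteq> [] \<longrightarrow> \<not> cancels p (hd w))"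
  by (auto simp: reduced_def successively_Cons)

lemma letter_act_closed:
  assumes "w \<in> reduced_words A" "fst p \<in> A"
  shows "letter_act p w \<in> reduced_words A"
  using assms by (cases w) (auto simp: reduced_words_def letter_act_def reduced_Cons)

lemma letter_act_inverse:
  assumes "w \<in> reduced_words A"
  shows "letter_act (x, \<not> b) (letter_act (x, b) w) = w"
  using assms
  by (cases w; cases "tl w")
     (auto simp: reduced_words_def letter_act_def reduced_Cons cancels_def)

definition letter_perm :: "'a set \<Rightarrow> 'a \<times> bool \<Rightarrow> 'a word \<Rightarrow> 'a word" where
  "letter_perm A p = restrict (letter_act p) (reduced_words A)"

lemma letter_perm_Bij:
  assumes "fst p \<in> A"
  shows "letter_perm A p \<in> Bij (reduced_words A)"
proof -
  obtain x b where p: "p = (x, b)" by (cases p)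
  have "bij_betw (letter_act (x, b)) (reduced_words A) (reduced_words A)"
    by (rule bij_betw_byWitness[where f' = "letter_act (x, \<not> b)"])
       (use assms p letter_act_inverse[of _ A x b] letter_act_inverse[of _ A x "\<not> b"]
          in \<open>auto intro: letter_act_closed\<close>)
  then show ?thesis
    by (auto simp: p letter_perm_def Bij_def cong: bij_betw_cong)
qed

lemma letter_perm_inv:
  assumes "x \<in> A"
  shows "inv\<^bsub>BijGroup (reduced_words A)\<^esub> letter_perm A (x, True) = letter_perm A (x, False)"
proof (rule group.inv_equality[OF group_BijGroup])
  have "letter_perm A (x, True) \<in> Bij (reduced_words A)"
       "letter_perm A (x, False) \<in> Bij (reduced_words A)"
    using assms by (simp_all add: letter_perm_Bij)
  then show "letter_perm A (x, False) \<otimes>\<^bsub>BijGroup (reduced_words A)\<^esub> letter_perm A (x, True) =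
      \<one>\<^bsub>BijGroup (reduced_words A)\<^esub>"
    using letter_act_inverse[of _ A x True] letter_act_closed[of _ A "(x, True)"] assms
    by (auto simp: BijGroup_def compose_def letter_perm_def fun_eq_iff)
qed (use assms in \<open>simp_all add: BijGroup_def letter_perm_Bij\<close>)

theorem ex_free_group_of_rank:
  "\<exists>G :: (nat word \<Rightarrow> nat word) monoid. free_group_of_rank G k"
proof -
  define A where "A = {..<k}"
  define S where "S = reduced_words A"
  define g where "g = (\<lambda>x. letter_perm A (x, True))"
  define X where "X = g ` A"
  define G where "G = (BijGroup S)\<lparr>carrier := generate (BijGroup S) X\<rparr>"
  interpret P: group "BijGroup S" by (rule group_BijGroup)
  have XP: "X \<subseteq> carrier (BijGroup S)"
    by (auto simp: X_def g_def BijGroup_def S_def letter_perm_Bij)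
  have sub: "subgroup (generate (BijGroup S) X) (BijGroup S)"
    using XP by (rule P.generate_is_subgroup)
  have grp: "group G"
    unfolding G_def using sub by (rule P.subgroup_imp_group)
  have XG: "X \<subseteq> carrier G"
    by (auto simp: G_def intro: generate.incl)
  have gen: "generate G X = carrier G"
    using P.generate_consistent[OF _ sub, of X] XG by (simp add: G_def)
  have Nil: "[] \<in> S"
    by (simp add: S_def reduced_words_def reduced_def)
  have g_Nil: "g x [] = [(x, True)]" for x
    using Nil by (simp add: g_def letter_perm_def S_def letter_act_def)
  have inj: "inj_on g A"
    by (rule inj_onI) (metis g_Nil list.inject prod.inject)
  have letter: "letter_eval G (g x, b) = letter_perm A (x, b)" if "x \<in> A" for x b
    using that P.m_inv_consistent[OF sub, of "g x"] letter_perm_inv[OF that] XG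
    by (cases b) (auto simp: letter_eval_def G_def g_def X_def S_def)
  have eval: "word_eval G (map (apfst g) v) \<in> Bij S \<and> word_eval G (map (apfst g) v) [] = v"
    if "v \<in> S" for v
    using that
  proof (induction v)
    case Nil
    then show ?case
      using id_Bij[of S] \<open>[] \<in> S\<close>
      by (auto simp: word_eval_def G_def BijGroup_def simp del: restrict_apply)
         (simp add: restrict_def)
  next
    case (Cons p v)
    then have v: "v \<in> S" and p: "fst p \<in> A" and pv: "letter_act p v = p # v"
      by (auto simp: S_def reduced_words_def reduced_Cons letter_act_def)
    obtain x b where xb: "p = (x, b)" by (cases p)
    have "word_eval G (map (apfst g) (p # v)) =
        letter_perm A p \<otimes>\<^bsub>BijGroup S\<^esub> word_eval G (map (apfst g) v)"
      using letter[of x b] p by (simp add: word_eval_def xb) (simp add: G_def)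
    also have "\<dots> = compose S (letter_perm A p) (word_eval G (map (apfst g) v))"
      using Cons.IH[OF v] letter_perm_Bij[OF p] by (simp add: BijGroup_def S_def)
    finally show ?case
      using Cons.IH[OF v] letter_perm_Bij[OF p] v pv \<open>[] \<in> S\<close>
      by (auto simp: compose_Bij S_def compose_eq letter_perm_def)
  qed
  have "word_eval G w \<noteq> \<one>\<^bsub>G\<^esub>" if w: "reduced w" "fst ` set w \<subseteq> X" "w \<noteq> []" for w
  proof
    assume one: "word_eval G w = \<one>\<^bsub>G\<^esub>"
    define v where "v = map (apfst (inv_into A g)) w"
    have vw: "map (apfst g) v = w"
      unfolding v_def map_map
    proof (rule map_idI)
      fix p assume "p \<in> set w"
      then have "fst p \<in> g ` A" using w(2) by (auto simp: X_def)
      then show "(apfst g \<circ> apfst (inv_into A g)) p = p"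
        by (cases p) (simp add: f_inv_into_f)
    qed
    have "reduced v"
      unfolding reduced_def v_def successively_map
    proof (rule successively_mono[OF w(1)[unfolded reduced_def]])
      fix p q assume pq: "p \<in> set w" "q \<in> set w" "\<not> cancels p q"
      then have "fst p \<in> g ` A" "fst q \<in> g ` A" using w(2) by (auto simp: X_def)
      with pq(3) show "\<not> cancels (apfst (inv_into A g) p) (apfst (inv_into A g) q)"
        by (auto simp: cancels_def dest: inv_into_injective)
    qed
    moreover have "fst ` set v \<subseteq> A"
    proof -
      have "inv_into A g y \<in> A" if "y \<in> X" for y
        using that unfolding X_def by (rule inv_into_into)
      then show ?thesis using w(2) by (force simp: v_def)
    qed
    ultimately have "word_eval G w [] = v"
      using eval[of v] vw by (simp add: S_def reduced_words_def)
    moreover have "\<one>\<^bsub>G\<^esub> [] = []"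
      using Nil by (simp add: G_def BijGroup_def)
    ultimately show False
      using one w(3) by (simp add: v_def)
  qed
  then have "free_basis G X"
    using XG gen by (auto simp: free_basis_def)
  moreover have "finite X" "card X = k"
    using inj by (simp_all add: X_def A_def card_image)
  ultimately show ?thesis
    using grp by (auto simp: free_group_of_rank_def)
qed

end

theory Submission
  imports Defs "HOL-Library.Z2" "HOL-Library.Function_Algebras"
begin

text \<open>
  Write \<open>w\<close> as a shortest possible word \<open>v\<close> over some free basis. If \<open>w\<close> is not primitive,
  then by Whitehead's argument the Whitehead graph of \<open>v\<close> (on the letters occurring in \<open>v\<close> and
  their inverses, with an edge for each pair of cyclically consecutive letters of \<open>v\<close>) is connected
  and remains so after the removal of any vertex or of any edge. Consequently no function on the Cayley
  tree with finite coboundary is constant along all axes of conjugates of \<open>v\<close> except one, along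
  which it jumps once. In other words, the Fox derivatives of \<open>v\<close> generate a proper one-sided ideal
  of \<open>\<bbbF>\<^sub>2[F]\<close>. The quotient by it is a cyclic module whose generator \<open>\<phi>\<close> survives in
  a finite module \<open>W\<close>, by a linear version of M. Hall's argument: restrict the letters to partial
  automorphisms of a finite subspace and extend these. Every derivation to the dual of \<open>W\<close> then maps
  \<open>w\<close> to a functional vanishing at \<open>\<phi>\<close>, whereas the value of a derivation at a primitive
  element can be prescribed. Since derivations are homomorphisms to a finite group, that group
  separates \<open>w\<close> from all primitive elements.
\<close>

text \<open>Closedness needs, for each non-primitive \<open>w\<close>, a single finite group that
  tells \<open>w\<close> from all primitive elements at once, although infinitely many bases are
  involved. Derivations meet this demand because \<open>W\<close> is built from \<open>w\<close>
  alone: only the homomorphism, not its target, depends on the primitive element.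

  The Whitehead graph is a local picture of the tree. The neighbours of a vertex \<open>u\<close>
  are the products \<open>p u\<close>, and the axes through \<open>u\<close> join \<open>p u\<close>
  to \<open>q u\<close> for the edges between \<open>p\<close> and \<open>q\<close> of the graph.
  They carry values of \<open>f\<close> at infinity from one branch to another. Away from the root,
  the branch towards the root has to be left out, hence a graph without one vertex; at the root, the
  axis with the jump has to be left out, hence a graph without one edge.

  The passage to Fox derivatives is duality: the indicator of a half-tree has finite coboundary, and
  its change under \<open>v\<close> is, up to translation, the Fox derivative of \<open>v\<close> by
  the letter of the edge bounding the half-tree. Coefficients modulo 2 remove all signs and make
  finitely generated modules finite when only finitely many translates matter.\<close>

section \<open>Words, formal inverses and multiplication of reduced words\<close>

definition letter_inv :: "'a \<times> bool \<Rightarrow> 'a \<times> bool" where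
  "letter_inv p = (fst p, \<not> snd p)"

definition word_inv :: "'a word \<Rightarrow> 'a word" where
  "word_inv u = rev (map letter_inv u)"

text \<open>Reduced words model the free group: for reduced \<open>w\<close>,
  \<open>word_act u w\<close> is the reduced form of the product \<open>u w\<close>. In particular
  \<open>word_act u []\<close> is the reduced form of \<open>u\<close>.\<close>

abbreviation word_act :: "'a word \<Rightarrow> 'a word \<Rightarrow> 'a word" where
  "word_act u w \<equiv> foldr letter_act u w"

abbreviation subst_eval :: "('b, 'm) monoid_scheme \<Rightarrow> ('a \<Rightarrow> 'b) \<Rightarrow> 'a word \<Rightarrow> 'b" where
  "subst_eval K h u \<equiv> word_eval K (map (apfst h) u)"

lemma letter_inv_inv [simp]: "letter_inv (letter_inv p) = p"
  by (simp add: letter_inv_def)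

lemma fst_letter_inv [simp]: "fst (letter_inv p) = fst p"
  by (simp add: letter_inv_def)

lemma letter_inv_neq [simp]: "letter_inv p \<noteq> p" "p \<noteq> letter_inv p"
  by (cases p; simp add: letter_inv_def)+

lemma cancels_iff: "cancels p q \<longleftrightarrow> q = letter_inv p"
  by (cases p; cases q) (auto simp: cancels_def letter_inv_def)

lemma letter_eq_or_inv: "fst p = fst q \<Longrightarrow> p = q \<or> p = letter_inv q"
  by (cases p; cases q) (auto simp: letter_inv_def)

lemma word_inv_simps [simp]:
  "word_inv [] = []" "word_inv (u @ w) = word_inv w @ word_inv u"
  "word_inv (p # w) = word_inv w @ [letter_inv p]" "word_inv (word_inv w) = w"
  "length (word_inv w) = length w" "word_inv w = [] \<longleftrightarrow> w = []"
  by (simp_all add: word_inv_def rev_map comp_def)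

lemma fst_set_word_inv [simp]: "fst ` set (word_inv u) = fst ` set u"
  by (force simp: word_inv_def letter_inv_def image_iff)

lemma Nil_in_reduced_words [simp]: "[] \<in> reduced_words A"
  by (simp add: reduced_words_def reduced_def)

lemma reduced_Cons_iff: "reduced (p # w) \<longleftrightarrow> reduced w \<and> (w \<noteq> [] \<longrightarrow> hd w \<noteq> letter_inv p)"
  by (simp add: reduced_Cons cancels_iff)

lemma letter_act_inv:
  assumes "w \<in> reduced_words A"
  shows "letter_act (letter_inv p) (letter_act p w) = w"
  using letter_act_inverse[OF assms, of "fst p" "snd p"] by (simp add: letter_inv_def)

lemma letter_act_Cons: "reduced (p # w) \<Longrightarrow> letter_act p w = p # w"
  by (auto simp: reduced_Cons letter_act_def)

lemma word_act_closed:
  assumes "w \<in> reduced_words A" "fst ` set u \<subseteq> A"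
  shows "word_act u w \<in> reduced_words A"
  using assms(2) by (induction u) (auto simp: assms(1) letter_act_closed)

lemma word_act_inv:
  assumes "w \<in> reduced_words A"
  shows "word_act (word_inv u) (word_act u w) = w"
  using assms
proof (induction u)
  case (Cons p u)
  have "w \<in> reduced_words UNIV"
    using Cons.prems by (simp add: reduced_words_def)
  then have "word_act u w \<in> reduced_words UNIV"
    by (rule word_act_closed) simp
  then show ?case
    using Cons by (simp add: letter_act_inv)
qed simp

lemma reduced_append_left: "reduced (u @ w) \<Longrightarrow> reduced u"
  by (simp add: reduced_def successively_append_iff)

lemma reduced_append_right: "reduced (u @ w) \<Longrightarrow> reduced w"
  by (simp add: reduced_def successively_append_iff)

lemma word_act_reduced: "reduced (u @ w) \<Longrightarrow> word_act u w = u @ w"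
  by (induction u) (auto simp: letter_act_Cons reduced_Cons)

lemma reduced_word_inv: "reduced u \<Longrightarrow> reduced (word_inv u)"
proof -
  have "cancels (letter_inv q) (letter_inv p) \<longleftrightarrow> cancels p q" for p q :: "'a \<times> bool"
    by (auto simp: cancels_def letter_inv_def)
  then show "reduced u \<Longrightarrow> reduced (word_inv u)"
    by (simp add: reduced_def word_inv_def successively_map)
qed

section \<open>Evaluation of words\<close>

context group
begin

lemma letter_eval_closed: "fst p \<in> carrier G \<Longrightarrow> letter_eval G p \<in> carrier G"
  by (simp add: letter_eval_def)

lemma letter_eval_inv: "fst p \<in> carrier G \<Longrightarrow> letter_eval G (letter_inv p) = inv (letter_eval G p)"
  by (simp add: letter_eval_def letter_inv_def)

lemma word_eval_simps [simp]:
  "word_eval G [] = \<one>" "word_eval G (p # u) = letter_eval G p \<otimes> word_eval G u"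
  by (simp_all add: word_eval_def)

lemma word_eval_closed: "fst ` set u \<subseteq> carrier G \<Longrightarrow> word_eval G u \<in> carrier G"
  by (induction u) (auto simp: letter_eval_closed)

lemma word_eval_append:
  "fst ` set u \<subseteq> carrier G \<Longrightarrow> fst ` set w \<subseteq> carrier G \<Longrightarrow>
    word_eval G (u @ w) = word_eval G u \<otimes> word_eval G w"
  by (induction u) (auto simp: letter_eval_closed word_eval_closed m_assoc)

lemma word_eval_inv:
  "fst ` set u \<subseteq> carrier G \<Longrightarrow> word_eval G (word_inv u) = inv (word_eval G u)"
  by (induction u)
     (auto simp: letter_eval_closed word_eval_closed word_eval_append letter_eval_inv inv_mult_group)

lemma subst_eval_letter_act:
  assumes "fst ` set (p # u) \<subseteq> A" "h \<in> A \<rightarrow> carrier G"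
  shows "subst_eval G h (letter_act p u) = subst_eval G h (p # u)"
proof (cases "u \<noteq> [] \<and> cancels p (hd u)")
  case True
  then obtain u' where u: "u = letter_inv p # u'"
    by (cases u) (auto simp: cancels_iff)
  have "apfst h (letter_inv p) = letter_inv (apfst h p)"
    by (simp add: letter_inv_def)
  moreover have "fst (apfst h p) \<in> carrier G"
    using assms by auto
  moreover have "subst_eval G h u' \<in> carrier G"
    using assms by (intro word_eval_closed) (force simp: u Pi_iff)
  ultimately show ?thesis
    by (simp add: u letter_act_def cancels_iff letter_eval_inv letter_eval_closed
        m_assoc[symmetric])
qed (auto simp: letter_act_def)

lemma subst_eval_word_act:
  assumes "fst ` set u \<subseteq> A" "h \<in> A \<rightarrow> carrier G"
  shows "subst_eval G h (word_act u []) = subst_eval G h u"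
  using assms(1)
proof (induction u)
  case (Cons p u)
  have "word_act u [] \<in> reduced_words A"
    using Cons.prems by (intro word_act_closed) auto
  then show ?case
    using Cons subst_eval_letter_act[of p "word_act u []" A h] assms(2)
    by (auto simp: reduced_words_def)
qed simp

lemma generate_word:
  assumes "g \<in> generate G B" "B \<subseteq> carrier G"
  obtains u where "fst ` set u \<subseteq> B" "word_eval G u = g"
proof -
  have "\<exists>u. fst ` set u \<subseteq> B \<and> word_eval G u = g"
    using assms(1)
  proof induction
    case one
    show ?case by (rule exI[of _ "[]"]) simp
  next
    case (incl b)
    then show ?case using assms(2)
      by (intro exI[of _ "[(b, True)]"]) (auto simp: letter_eval_def)
  next
    case (inv b)
    then show ?case using assms(2)
      by (intro exI[of _ "[(b, False)]"]) (auto simp: letter_eval_def)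
  next
    case (eng g h)
    then obtain u w where "fst ` set u \<subseteq> B" "word_eval G u = g" "fst ` set w \<subseteq> B" "word_eval G w = h"
      by blast
    then show ?case using assms(2)
      by (intro exI[of _ "u @ w"]) (auto simp: word_eval_append)
  qed
  then show thesis using that by blast
qed

end

lemma hom_word_eval:
  assumes "group G" "group K" "\<theta> \<in> hom G K" "fst ` set u \<subseteq> carrier G"
  shows "\<theta> (word_eval G u) = subst_eval K \<theta> u"
proof -
  interpret group_hom G K \<theta>
    using assms by (simp add: group_hom_def group_hom_axioms_def)
  show ?thesis
    using assms(4)
  proof (induction u)
    case (Cons p u)
    then have "\<theta> (letter_eval G p) = letter_eval K (apfst \<theta> p)"
      by (simp add: letter_eval_def)
    with Cons show ?case
      by (simp add: G.letter_eval_closed G.word_eval_closed)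
  qed simp
qed

lemma subst_eval_cong:
  "(\<And>x. x \<in> fst ` set u \<Longrightarrow> h x = h' x) \<Longrightarrow> subst_eval K h u = subst_eval K h' u"
  by (intro arg_cong[of _ _ "word_eval K"] map_cong) (auto intro!: prod_eqI)

section \<open>Free bases\<close>

text \<open>A relation between free generators cancels to the empty word, and substituting arbitrary
  values respects cancellation. This is what makes \<open>free_basis_hom\<close> well
  defined.\<close>

lemma free_basis_subst_one:
  assumes "group G" "group K" and B: "free_basis G B" and h: "h \<in> B \<rightarrow> carrier K"
    and u: "fst ` set u \<subseteq> B" "word_eval G u = \<one>\<^bsub>G\<^esub>"
  shows "subst_eval K h u = \<one>\<^bsub>K\<^esub>"
proof -
  interpret G: group G by fact
  interpret K: group K by fact
  let ?r = "word_act u []"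
  have "?r \<in> reduced_words B"
    using u by (intro word_act_closed) auto
  moreover have "word_eval G ?r = \<one>\<^bsub>G\<^esub>"
    using G.subst_eval_word_act[OF u(1), of id] u(2) B
    by (simp add: free_basis_def apfst_id Pi_iff subset_eq)
  ultimately have "?r = []"
    using B by (auto simp: free_basis_def reduced_words_def)
  then show ?thesis
    using K.subst_eval_word_act[OF u(1) h] by simp
qed

lemma free_basis_word:
  assumes "group G" "free_basis G B" "g \<in> carrier G"
  obtains u where "fst ` set u \<subseteq> B" "word_eval G u = g"
  using group.generate_word[OF assms(1), of g B] assms by (auto simp: free_basis_def)

theorem free_basis_hom:
  assumes "group G" "group K" and B: "free_basis G B" and h: "h \<in> B \<rightarrow> carrier K"
  obtains \<theta> where "\<theta> \<in> hom G K" "\<And>b. b \<in> B \<Longrightarrow> \<theta> b = h b"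
proof -
  interpret G: group G by fact
  interpret K: group K by fact
  have BG: "B \<subseteq> carrier G" using B by (simp add: free_basis_def)
  have hK: "fst ` set (map (apfst h) u) \<subseteq> carrier K" if "fst ` set u \<subseteq> B" for u
    using that h by (auto simp: Pi_iff image_subset_iff)
  have inv_map: "map (apfst h) (word_inv u) = word_inv (map (apfst h) u)" for u
    by (simp add: word_inv_def rev_map letter_inv_def)
  have wd: "subst_eval K h u = subst_eval K h u'"
    if "fst ` set u \<subseteq> B" "fst ` set u' \<subseteq> B" "word_eval G u = word_eval G u'" for u u'
  proof -
    have "fst ` set u \<subseteq> carrier G" "fst ` set u' \<subseteq> carrier G"
      using that BG by auto
    then have "word_eval G (u @ word_inv u') = \<one>\<^bsub>G\<^esub>"
      using that by (simp add: G.word_eval_append G.word_eval_inv G.word_eval_closed)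
    then have "subst_eval K h (u @ word_inv u') = \<one>\<^bsub>K\<^esub>"
      using that by (intro free_basis_subst_one[OF assms]) (auto simp: image_Un)
    then have "subst_eval K h u \<otimes>\<^bsub>K\<^esub> inv\<^bsub>K\<^esub> subst_eval K h u' = \<one>\<^bsub>K\<^esub>"
      using hK[of u] hK[of u'] that
      by (simp only: inv_map map_append K.word_eval_append K.word_eval_inv fst_set_word_inv)
    then show ?thesis
      using hK that by (metis K.inv_equality K.inv_closed K.inv_inv K.word_eval_closed)
  qed
  define W where "W g = (SOME u. fst ` set u \<subseteq> B \<and> word_eval G u = g)" for g
  have W: "fst ` set (W g) \<subseteq> B" "word_eval G (W g) = g" if "g \<in> carrier G" for g
    using free_basis_word[OF assms(1) B that]
      someI[of "\<lambda>u. fst ` set u \<subseteq> B \<and> word_eval G u = g"] unfolding W_def by metis+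
  define \<theta> where "\<theta> g = subst_eval K h (W g)" for g
  have eq: "\<theta> (word_eval G u) = subst_eval K h u" if "fst ` set u \<subseteq> B" for u
    unfolding \<theta>_def using that BG by (intro wd W) (auto intro!: W G.word_eval_closed)
  show thesis
  proof
    show "\<theta> \<in> hom G K"
    proof (rule homI)
      show "\<theta> g \<in> carrier K" if "g \<in> carrier G" for g
        unfolding \<theta>_def using W[OF that] hK[of "W g"] by (intro K.word_eval_closed)
      show "\<theta> (g \<otimes>\<^bsub>G\<^esub> g') = \<theta> g \<otimes>\<^bsub>K\<^esub> \<theta> g'" if "g \<in> carrier G" "g' \<in> carrier G" for g g'
      proof -
        have "g \<otimes>\<^bsub>G\<^esub> g' = word_eval G (W g @ W g')"
          using W[OF that(1)] W[OF that(2)] BG by (subst G.word_eval_append) auto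
        then have "\<theta> (g \<otimes>\<^bsub>G\<^esub> g') = subst_eval K h (W g @ W g')"
          using eq[of "W g @ W g'"] W[OF that(1)] W[OF that(2)] by (simp add: image_Un)
        then show ?thesis
          unfolding \<theta>_def map_append
          by (subst (asm) K.word_eval_append) (use W[OF that(1)] W[OF that(2)] hK in blast)+
      qed
    qed
    show "\<theta> b = h b" if "b \<in> B" for b
    proof -
      have "h b \<in> carrier K" "b \<in> carrier G" using that h BG by auto
      then show ?thesis
        using eq[of "[(b, True)]"] that by (simp add: letter_eval_def)
    qed
  qed
qed

lemma free_basis_hom_eq:
  assumes "group G" "group K" "free_basis G B" "\<theta> \<in> hom G K" "\<eta> \<in> hom G K"
    "\<And>b. b \<in> B \<Longrightarrow> \<theta> b = \<eta> b" "g \<in> carrier G"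
  shows "\<theta> g = \<eta> g"
proof -
  obtain u where u: "fst ` set u \<subseteq> B" "word_eval G u = g"
    by (rule free_basis_word[OF assms(1,3,7)])
  then have uG: "fst ` set u \<subseteq> carrier G"
    using assms(3) by (auto simp: free_basis_def)
  have "subst_eval K \<theta> u = subst_eval K \<eta> u"
    using u assms(6) by (intro subst_eval_cong) blast
  then show ?thesis
    using hom_word_eval[OF assms(1,2,4) uG] hom_word_eval[OF assms(1,2,5) uG] u by simp
qed

lemma free_basis_automorphism:
  assumes "group G" and B: "free_basis G B"
    and \<psi>: "\<psi> \<in> hom G G" "\<beta> \<in> hom G G" "\<And>g. g \<in> carrier G \<Longrightarrow> \<beta> (\<psi> g) = g"
      "\<And>g. g \<in> carrier G \<Longrightarrow> \<psi> (\<beta> g) = g"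
  shows "free_basis G (\<psi> ` B)"
proof -
  interpret G: group G by fact
  have BG: "B \<subseteq> carrier G" using B by (simp add: free_basis_def)
  have im: "\<psi> ` B \<subseteq> carrier G" using BG \<psi>(1) by (auto simp: hom_def)
  have "g \<in> generate G (\<psi> ` B)" if g: "g \<in> carrier G" for g
  proof -
    interpret group_hom G G \<psi>
      using \<psi> by (simp add: group_hom_def group_hom_axioms_def G.group_axioms)
    have "\<beta> g \<in> generate G B" using g B \<psi>(2) by (auto simp: free_basis_def hom_def)
    then have "\<psi> (\<beta> g) \<in> generate G (\<psi> ` B)"
      using generate_img[OF BG] by auto
    then show ?thesis using g \<psi>(4) by simp
  qed
  then have "generate G (\<psi> ` B) = carrier G"
    using G.generate_incl[OF im] by blast
  moreover have "word_eval G w \<noteq> \<one>\<^bsub>G\<^esub>" if w: "reduced w" "fst ` set w \<subseteq> \<psi> ` B" "w \<noteq> []" for w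
  proof
    assume one: "word_eval G w = \<one>\<^bsub>G\<^esub>"
    have "\<beta> (word_eval G w) = word_eval G (map (apfst \<beta>) w)"
      using w im by (intro hom_word_eval \<psi> G.group_axioms) auto
    then have "word_eval G (map (apfst \<beta>) w) = \<one>\<^bsub>G\<^esub>"
      using one hom_one[OF \<psi>(2)] G.group_axioms by simp
    moreover have "fst ` set (map (apfst \<beta>) w) \<subseteq> B"
    proof -
      have "\<beta> x \<in> B" if "x \<in> \<psi> ` B" for x
        using that \<psi>(3) BG by auto
      then show ?thesis using w(2) by (auto simp: image_subset_iff)
    qed
    moreover have "reduced (map (apfst \<beta>) w)"
      unfolding reduced_def successively_map
    proof (rule successively_mono[OF w(1)[unfolded reduced_def]])
      fix p q assume pq: "p \<in> set w" "q \<in> set w" "\<not> cancels p q"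
      have "\<psi> (\<beta> (fst p)) = fst p" "\<psi> (\<beta> (fst q)) = fst q"
        using pq w(2) im \<psi>(4) by (meson image_subset_iff subsetD)+
      then show "\<not> cancels (apfst \<beta> p) (apfst \<beta> q)"
        using pq(3) by (auto simp: cancels_def)
    qed
    ultimately show False
      using B w(3) by (simp add: free_basis_def)
  qed
  ultimately show ?thesis
    using im by (simp add: free_basis_def)
qed

section \<open>Separation by finite quotients\<close>

text \<open>A homomorphism is determined by its values on the finite set \<open>X\<close>, so only
  finitely many different kernels are intersected.\<close>

lemma (in group) finite_index_hom_kernels:
  assumes X: "free_basis G X" "finite X" and K: "group K" "finite (carrier K)"
  shows "finite_index_subgroup {g \<in> carrier G. \<forall>\<theta>\<in>hom G K. \<theta> g = \<one>\<^bsub>K\<^esub>} G"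
    (is "finite_index_subgroup ?N G")
proof -
  have gh: "group_hom G K \<theta>" if "\<theta> \<in> hom G K" for \<theta>
    using that K by (simp add: group_hom_def group_hom_axioms_def group_axioms)
  interpret K: group K by fact
  have sub: "subgroup ?N G"
  proof
    show "inv g \<in> ?N" if "g \<in> ?N" for g
      using that by (auto simp: group_hom.hom_inv[OF gh])
    show "g \<otimes> h \<in> ?N" if "g \<in> ?N" "h \<in> ?N" for g h
    proof -
      have "\<theta> (g \<otimes> h) = \<one>\<^bsub>K\<^esub>" if "\<theta> \<in> hom G K" for \<theta>
      proof -
        have "\<theta> g = \<one>\<^bsub>K\<^esub>" "\<theta> h = \<one>\<^bsub>K\<^esub>"
          using \<open>g \<in> ?N\<close> \<open>h \<in> ?N\<close> that by blast+
        then show ?thesis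
          using \<open>g \<in> ?N\<close> \<open>h \<in> ?N\<close> by (simp add: hom_mult[OF that])
      qed
      then show ?thesis using that by simp
    qed
  qed (auto simp: hom_mult group_hom.hom_one[OF gh])
  define T where "T = (X \<rightarrow>\<^sub>E carrier K)"
  have T: "finite T"
    unfolding T_def using X K by (intro finite_PiE) auto
  \<comment> \<open>\<open>hom G K\<close> itself can be infinite, because its members are arbitrary
    off \<open>carrier G\<close>. So one representative is chosen for each assignment of values to
    \<open>X\<close>.\<close>
  have "\<exists>\<theta>\<in>hom G K. \<forall>x\<in>X. \<theta> x = h x" if "h \<in> T" for h
    using free_basis_hom[OF group_axioms K(1) X(1), of h] that
    unfolding T_def by (metis PiE_iff Pi_iff)
  then obtain \<Theta> where \<Theta>: "\<And>h. h \<in> T \<Longrightarrow> \<Theta> h \<in> hom G K" "\<And>h x. h \<in> T \<Longrightarrow> x \<in> X \<Longrightarrow> \<Theta> h x = h x"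
    by metis
  define E where "E g = (\<lambda>h\<in>T. \<Theta> h g)" for g
  have "E ` carrier G \<subseteq> T \<rightarrow>\<^sub>E carrier K"
    using hom_in_carrier[OF \<Theta>(1)] by (auto simp: E_def)
  then have fin: "finite (E ` carrier G)"
    by (rule finite_subset) (use T K in \<open>auto intro: finite_PiE\<close>)
  have key: "?N #> a = ?N #> b" if ab: "a \<in> carrier G" "b \<in> carrier G" "E a = E b" for a b
  proof -
    have "\<theta> (a \<otimes> inv b) = \<one>\<^bsub>K\<^esub>" if \<theta>: "\<theta> \<in> hom G K" for \<theta>
    proof -
      define h where "h = restrict \<theta> X"
      have hx: "h x = \<theta> x" if "x \<in> X" for x
        using that by (simp add: h_def)
      have h: "h \<in> T"
        unfolding h_def using \<theta> X(1) by (auto simp: T_def hom_def free_basis_def)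
      have "\<Theta> h g = \<theta> g" if "g \<in> carrier G" for g
        by (rule free_basis_hom_eq[OF group_axioms K(1) X(1)]) (use \<Theta> h hx \<theta> that in auto)
      moreover have "\<Theta> h a = \<Theta> h b"
        using fun_cong[OF ab(3), of h] h by (simp add: E_def)
      ultimately have "\<theta> a = \<theta> b" using ab by simp
      then show ?thesis
        using \<theta> ab hom_in_carrier[OF \<theta> ab(2)] by (simp add: hom_mult group_hom.hom_inv[OF gh])
    qed
    then have "a \<otimes> inv b \<in> ?N"
      using ab by simp
    moreover have "a = (a \<otimes> inv b) \<otimes> b"
      using ab by (simp add: m_assoc)
    ultimately have "a \<in> ?N #> b"
      unfolding r_coset_def by blast
    then show ?thesis
      using repr_independence[OF _ ab(2) sub] by simp
  qed
  have "rcosets ?N \<subseteq> (\<lambda>e. ?N #> inv_into (carrier G) E e) ` E ` carrier G"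
  proof
    fix C assume "C \<in> rcosets ?N"
    then obtain a where a: "a \<in> carrier G" "C = ?N #> a"
      by (auto simp: RCOSETS_def)
    have "C = ?N #> inv_into (carrier G) E (E a)"
      unfolding a(2) using a(1) by (intro key) (auto simp: inv_into_into f_inv_into_f)
    then show "C \<in> (\<lambda>e. ?N #> inv_into (carrier G) E e) ` E ` carrier G"
      using a(1) by blast
  qed
  then have "finite (rcosets ?N)"
    by (rule finite_subset) (use fin in auto)
  with sub show ?thesis
    by (simp add: finite_index_subgroup_def)
qed

text \<open>\<open>K\<close> may depend on \<open>w\<close> but not on \<open>p\<close>, whereas the
  homomorphism may depend on both: the coset of \<open>w\<close> modulo the common kernel of all
  homomorphisms to \<open>K\<close> then misses the whole of \<open>P\<close>.\<close>

lemma (in group) closedin_profinite_topology_if_separated: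
  assumes X: "free_basis G X" "finite X" and P: "P \<subseteq> carrier G"
    and sep: "\<And>w. w \<in> carrier G - P \<Longrightarrow> \<exists>K :: 'c monoid. group K \<and> finite (carrier K) \<and>
      (\<forall>p\<in>P. \<exists>\<theta>\<in>hom G K. \<theta> p \<noteq> \<theta> w)"
  shows "closedin (profinite_topology G) P"
proof -
  have "\<exists>C\<in>finite_index_cosets G. w \<in> C \<and> C \<subseteq> carrier G - P" if w: "w \<in> carrier G - P" for w
  proof -
    obtain K :: "'c monoid" where K: "group K" "finite (carrier K)"
      "\<And>p. p \<in> P \<Longrightarrow> \<exists>\<theta>\<in>hom G K. \<theta> p \<noteq> \<theta> w"
      using sep[OF w] by blast
    interpret K: group K by fact
    define N where "N = {g \<in> carrier G. \<forall>\<theta>\<in>hom G K. \<theta> g = \<one>\<^bsub>K\<^esub>}"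
    have N: "finite_index_subgroup N G"
      unfolding N_def by (rule finite_index_hom_kernels[OF X K(1,2)])
    have "p \<notin> N #> w" if "p \<in> P" for p
    proof
      assume "p \<in> N #> w"
      then obtain g where g: "g \<in> N" "p = g \<otimes> w"
        by (auto simp: r_coset_def)
      have "\<theta> p = \<theta> w" if "\<theta> \<in> hom G K" for \<theta>
        using g w that by (auto simp: N_def hom_mult hom_in_carrier)
      then show False using K(3)[OF that] by blast
    qed
    moreover have "N #> w \<subseteq> carrier G"
      using w by (auto simp: N_def r_coset_def)
    moreover have "w \<in> N #> w"
      using rcos_self w N by (auto simp: finite_index_subgroup_def)
    moreover have "N #> w \<in> finite_index_cosets G"
      using N w by (auto simp: finite_index_cosets_def RCOSETS_def)
    ultimately show ?thesis by blast
  qed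
  then have "\<exists>\<B>. \<B> \<subseteq> finite_index_cosets G \<and> carrier G - P = \<Union>\<B>"
    by (intro exI[of _ "{C \<in> finite_index_cosets G. C \<subseteq> carrier G - P}"]) blast
  then show ?thesis
    using P by (simp add: closedin_def topspace_profinite_topology openin_profinite_topology)
qed

section \<open>Almost invariant functions on the Cayley tree\<close>

lemma reduced_nth: "reduced v \<longleftrightarrow> (\<forall>j. Suc j < length v \<longrightarrow> v ! Suc j \<noteq> letter_inv (v ! j))"
  by (auto simp: reduced_def successively_conv_nth cancels_iff)

lemma reduced_append_Cons: "reduced (y @ [p]) \<Longrightarrow> reduced (p # u) \<Longrightarrow> reduced (y @ p # u)"
  by (auto simp: reduced_def successively_append_iff)

definition cyclically_reduced :: "'a word \<Rightarrow> bool" where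
  "cyclically_reduced v \<longleftrightarrow>
    (\<forall>j < length v. v ! (Suc j mod length v) \<noteq> letter_inv (v ! j))"

lemma cyclically_reduced_imp_reduced: "cyclically_reduced v \<Longrightarrow> reduced v"
  unfolding cyclically_reduced_def reduced_nth by (metis Suc_lessD mod_less)

abbreviation word_power :: "'a word \<Rightarrow> nat \<Rightarrow> 'a word" where
  "word_power v m \<equiv> concat (replicate m v)"

lemma word_power_Suc: "word_power v (Suc m) = word_power v m @ v"
  by (induction m) auto

lemma length_word_power [simp]: "length (word_power v m) = m * length v"
  by (induction m) auto

lemma reduced_word_power:
  assumes "cyclically_reduced v"
  shows "reduced (word_power v m)"
proof (induction m)
  case (Suc m)
  have v: "reduced v" using assms by (rule cyclically_reduced_imp_reduced)
  show ?case
  proof (cases "m = 0 \<or> v = []")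
    case False
    then have "hd (word_power v m) = hd v" "word_power v m \<noteq> []"
      by (cases m; simp)+
    moreover have "hd v \<noteq> letter_inv (last v)"
      using assms[unfolded cyclically_reduced_def, rule_format, of "length v - 1"] False
      by (simp add: hd_conv_nth last_conv_nth)
    ultimately show ?thesis
      using Suc v by (simp add: reduced_def successively_append_iff cancels_iff)
  qed (use v in auto)
qed (simp add: reduced_def)

text \<open>The rays from \<open>u\<close> through its two neighbours on an axis are pushed along that axis by
  powers of \<open>v\<close>, so \<open>f\<close> agrees on them unless the axis passes through the exceptional
  vertex \<open>[]\<close>.\<close>

lemma axis_values:
  fixes v :: "'a word" and f :: "'a word \<Rightarrow> 'b"
  defines "A \<equiv> fst ` set v"
  assumes v: "cyclically_reduced v"
    and f: "\<And>u. u \<in> reduced_words A \<Longrightarrow> u \<noteq> [] \<Longrightarrow> f (word_act v u) = f u"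
    and j: "j < length v" and p: "p = v ! j" and q: "q = letter_inv (v ! (Suc j mod length v))"
    and u: "p # u \<in> reduced_words A" "q # u \<in> reduced_words A"
  obtains y z where "length y \<ge> m" "length z \<ge> m" "y @ p # u \<in> reduced_words A"
    "z @ q # u \<in> reduced_words A"
    "u \<noteq> [] \<or> Suc j < length v \<Longrightarrow> f (y @ p # u) = f (z @ q # u)"
    "u = [] \<Longrightarrow> Suc j = length v \<Longrightarrow> f (y @ p # u) = f v \<and> f (z @ q # u) = f []"
proof -
  let ?n = "length v"
  have R: "u \<in> reduced_words A"
    using u by (auto simp: reduced_words_def reduced_Cons)
  have pA: "fst p \<in> A" and qA: "fst q \<in> A"
    using u by (auto simp: reduced_words_def)
  \<comment> \<open>\<open>a m\<close> and \<open>b m\<close> lie on the axis through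
    \<open>u\<close>, on the side of \<open>p u\<close> and of \<open>q u\<close> respectively.
    Raising \<open>m\<close> by one multiplies by \<open>v\<close> on the first ray and by its
    inverse on the second, and one further multiplication by \<open>v\<close> leads from
    \<open>b 0\<close> to \<open>a 0\<close>.\<close>
  define a where "a m = word_act (word_power v m @ take (Suc j) v) u" for m
  define b where "b m = word_act (word_inv (drop (Suc j) v @ word_power v m)) u" for m
  have sets: "fst ` set (word_power v m @ take k v) \<subseteq> A" "fst ` set (drop k v @ word_power v m) \<subseteq> A"
    for m k
    unfolding A_def using set_take_subset[of k v] set_drop_subset[of k v]
    by (intro image_mono; cases m; force)+
  have a: "a m = (word_power v m @ take j v) @ p # u" "a m \<in> reduced_words A" for m
  proof -
    have "reduced ((word_power v m @ take j v) @ [p])"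
      using reduced_word_power[OF v, of "Suc m"] id_take_nth_drop[OF j]
      unfolding word_power_Suc p
      by (intro reduced_append_left[of "(word_power v m @ take j v) @ [v ! j]" "drop (Suc j) v"])
         (metis append.assoc append_Cons append_Nil)
    then have "reduced ((word_power v m @ take j v) @ p # u)"
      by (rule reduced_append_Cons) (use u in \<open>auto simp: reduced_words_def\<close>)
    moreover have "(word_power v m @ take j v) @ p # u = (word_power v m @ take (Suc j) v) @ u"
      using j by (simp add: take_Suc_conv_app_nth p)
    ultimately show "a m = (word_power v m @ take j v) @ p # u"
      unfolding a_def by (simp only: word_act_reduced)
    show "a m \<in> reduced_words A"
      unfolding a_def by (rule word_act_closed[OF R sets(1)])
  qed
  have b: "b (Suc m) = word_inv (tl (drop (Suc j) v @ word_power v (Suc m))) @ q # u"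
    "b m \<in> reduced_words A" for m
  proof -
    let ?w = "drop (Suc j) v @ word_power v (Suc m)"
    have "hd ?w = letter_inv q"
      using j by (cases "Suc j = ?n") (auto simp: q hd_append hd_drop_conv_nth hd_conv_nth)
    moreover have "?w \<noteq> []" using j by auto
    ultimately have w: "word_inv ?w = word_inv (tl ?w) @ [q]"
      by (metis letter_inv_inv list.exhaust_sel word_inv_simps(3))
    have "take (Suc j) v @ ?w = word_power v (Suc (Suc m))"
      by (metis append.assoc append_take_drop_id concat.simps(2) replicate_Suc)
    then have "reduced ?w"
      using reduced_word_power[OF v] reduced_append_right by metis
    then have "reduced (word_inv (tl ?w) @ [q])"
      using reduced_word_inv w by metis
    then have "reduced (word_inv (tl ?w) @ q # u)"
      by (rule reduced_append_Cons) (use u in \<open>auto simp: reduced_words_def\<close>)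
    moreover have "word_inv (tl ?w) @ q # u = word_inv ?w @ u"
      unfolding w by simp
    ultimately show "b (Suc m) = word_inv (tl ?w) @ q # u"
      unfolding b_def by (simp only: word_act_reduced)
    show "b m \<in> reduced_words A"
      unfolding b_def by (rule word_act_closed[OF R]) (simp only: fst_set_word_inv sets(2))
  qed
  have "f (a m) = f (a 0)" for m
  proof (induction m)
    case (Suc m)
    have "a (Suc m) = word_act v (a m)"
      by (simp add: a_def)
    moreover have "a m \<noteq> []" using a(1)[of m] by simp
    ultimately show ?case
      using f[OF a(2)] Suc by simp
  qed simp
  moreover have "f (b (Suc m)) = f (b 0)" for m
  proof -
    have step: "f (b (Suc m)) = f (b m)" for m
    proof -
      have "b (Suc m) = word_act (word_inv v) (b m)"
        unfolding b_def word_power_Suc by (simp only: word_inv_simps append_assoc[symmetric] foldr_append comp_def)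
      then have "word_act v (b (Suc m)) = b m"
        using word_act_inv[OF b(2), of "word_inv v" m] by simp
      moreover have "b (Suc m) \<noteq> []" using b(1)[of m] by simp
      ultimately show ?thesis
        using f[OF b(2), of "Suc m"] by simp
    qed
    show ?thesis by (induction m) (simp_all add: step)
  qed
  moreover have "a 0 = word_act v (b 0)"
  proof -
    have "word_act v (b 0) = word_act (take (Suc j) v) (word_act (drop (Suc j) v) (b 0))"
      by (metis append_take_drop_id foldr_append comp_apply)
    also have "word_act (drop (Suc j) v) (b 0) = u"
      using word_act_inv[OF R, of "word_inv (drop (Suc j) v)"] by (simp add: b_def)
    finally show ?thesis by (simp add: a_def)
  qed
  \<comment> \<open>If \<open>b 0\<close> were \<open>[]\<close> although letters of
    \<open>v\<close> remain after position \<open>j\<close>, then \<open>u\<close> would be that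
    remainder. It begins with the inverse of \<open>q\<close>, so \<open>q # u\<close> would not be
    reduced.\<close>
  moreover have "b 0 \<noteq> []" if "u \<noteq> [] \<or> Suc j < length v"
  proof (cases "Suc j = ?n")
    case True
    then show ?thesis using that by (simp add: b_def)
  next
    case False
    have "word_act (drop (Suc j) v) (b 0) = u"
      using word_act_inv[OF R, of "word_inv (drop (Suc j) v)"] by (simp add: b_def)
    moreover have "word_act (drop (Suc j) v) [] = drop (Suc j) v"
      using word_act_reduced[of "drop (Suc j) v" "[]"] cyclically_reduced_imp_reduced[OF v]
      by (metis append.right_neutral append_take_drop_id reduced_append_right)
    moreover have "q # drop (Suc j) v \<notin> reduced_words A"
      using False j by (auto simp: reduced_words_def reduced_Cons_iff q hd_drop_conv_nth)
    ultimately show ?thesis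
      using u(2) by metis
  qed
  ultimately have "u \<noteq> [] \<or> Suc j < length v \<Longrightarrow> f (a m) = f (b (Suc m))"
    using f[OF b(2), of 0] by simp
  moreover have "f (a m) = f v \<and> f (b (Suc m)) = f []" if "u = []" "Suc j = length v"
  proof -
    have "a 0 = v" using that cyclically_reduced_imp_reduced[OF v] word_act_reduced[of v "[]"]
      by (simp add: a_def)
    moreover have "b 0 = []" using that by (simp add: b_def)
    ultimately show ?thesis
      using \<open>\<And>m. f (a m) = f (a 0)\<close> \<open>\<And>m. f (b (Suc m)) = f (b 0)\<close> by simp
  qed
  moreover have "m \<le> length (word_power v m @ take j v)"
    "m \<le> length (word_inv (tl (drop (Suc j) v @ word_power v (Suc m))))"
  proof -
    have "m \<le> m * ?n" using j by (cases ?n) auto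
    then show "m \<le> length (word_power v m @ take j v)"
      unfolding length_append length_word_power by linarith
    have "length (word_inv (tl (drop (Suc j) v @ word_power v (Suc m)))) = ?n + m * ?n + (?n - Suc j) - 1"
      by simp
    also have "\<dots> \<ge> m"
      using \<open>m \<le> m * ?n\<close> j by linarith
    finally show "m \<le> length (word_inv (tl (drop (Suc j) v @ word_power v (Suc m))))" .
  qed
  ultimately show thesis
    using a[of m] b(1)[of m] b(2)[of "Suc m"]
    by (intro that[of "word_power v m @ take j v" "word_inv (tl (drop (Suc j) v @ word_power v (Suc m)))"])
       (simp_all only:)
qed

definition almost_invariant :: "'a set \<Rightarrow> ('a word \<Rightarrow> 'b) \<Rightarrow> bool" where
  "almost_invariant A f \<longleftrightarrow>
    finite {(p, u). fst p \<in> A \<and> u \<in> reduced_words A \<and> f (letter_act p u) \<noteq> f u}"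

text \<open>Downward induction on the length of \<open>u\<close>: the half-tree beyond \<open>u\<close> has a single end value.\<close>

lemma no_almost_invariant_function:
  fixes v :: "'a word" and f :: "'a word \<Rightarrow> 'b"
  defines "A \<equiv> fst ` set v"
  assumes v: "v \<noteq> []" "cyclically_reduced v"
    and fin: "almost_invariant A f"
    and f: "\<And>u. u \<in> reduced_words A \<Longrightarrow> u \<noteq> [] \<Longrightarrow> f (word_act v u) = f u" "f v \<noteq> f []"
    and conn1: "\<And>a S. fst a \<in> A \<Longrightarrow> S \<subseteq> A \<times> UNIV - {a} \<Longrightarrow> S \<noteq> {} \<Longrightarrow>
      (\<And>j p q. j < length v \<Longrightarrow> p = v ! j \<Longrightarrow> q = letter_inv (v ! (Suc j mod length v)) \<Longrightarrow>
         p \<noteq> a \<Longrightarrow> q \<noteq> a \<Longrightarrow> p \<in> S \<longleftrightarrow> q \<in> S) \<Longrightarrow> S = A \<times> UNIV - {a}"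
    and conn2: "\<And>S. S \<subseteq> A \<times> UNIV \<Longrightarrow> S \<noteq> {} \<Longrightarrow>
      (\<And>j. Suc j < length v \<Longrightarrow> v ! j \<in> S \<longleftrightarrow> letter_inv (v ! Suc j) \<in> S) \<Longrightarrow> S = A \<times> UNIV"
  shows False
proof -
  let ?n = "length v" and ?L = "A \<times> (UNIV :: bool set)"
  have L: "finite ?L" by (simp add: A_def)
  \<comment> \<open>The words ending in \<open>u\<close> form the half-tree beyond \<open>u\<close>.
    The depth \<open>M\<close> is uniform, so both ends of an axis can be pushed to where
    \<open>f\<close> has its end value.\<close>
  define F where "F u t \<longleftrightarrow> (\<exists>M. \<forall>y. length y \<ge> M \<and> y @ u \<in> reduced_words A \<longrightarrow> f (y @ u) = t)" for u t
  have line: "t = t'"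
    if *: "j < ?n" "p = v ! j" "q = letter_inv (v ! (Suc j mod ?n))" "p # u \<in> reduced_words A"
      "q # u \<in> reduced_words A" "F (p # u) t" "F (q # u) t'" "u \<noteq> [] \<or> Suc j < ?n" for j p q u t t'
  proof -
    obtain M where M: "\<And>y. length y \<ge> M \<Longrightarrow> y @ p # u \<in> reduced_words A \<Longrightarrow> f (y @ p # u) = t"
      using *(6) by (auto simp: F_def)
    obtain M' where M': "\<And>y. length y \<ge> M' \<Longrightarrow> y @ q # u \<in> reduced_words A \<Longrightarrow> f (y @ q # u) = t'"
      using *(7) by (auto simp: F_def)
    obtain y z where "max M M' \<le> length y" "max M M' \<le> length z" "y @ p # u \<in> reduced_words A"
      "z @ q # u \<in> reduced_words A" "f (y @ p # u) = f (z @ q # u)"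
      by (rule axis_values[where v = v and f = f and u = u and m = "max M M'" and j = j and p = p
            and q = q, folded A_def]) (use * v f in blast)+
    then show ?thesis
      using M[of y] M'[of z] by simp
  qed
  \<comment> \<open>Below depth \<open>r\<close> no edge changes \<open>f\<close>; this is the base
    of the induction.\<close>
  obtain r where r: "\<And>p u. fst p \<in> A \<Longrightarrow> u \<in> reduced_words A \<Longrightarrow> r \<le> length u \<Longrightarrow> f (letter_act p u) = f u"
  proof -
    let ?D = "{(p, u). fst p \<in> A \<and> u \<in> reduced_words A \<and> f (letter_act p u) \<noteq> f u}"
    obtain r where "\<forall>k \<in> (\<lambda>(p, u). length u) ` ?D. k < r"
      using fin[unfolded almost_invariant_def] finite_nat_set_iff_bounded by (metis (no_types, lifting) finite_imageI)
    then show thesis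
      by (intro that[of r]) fastforce
  qed
  have beyond: "f (y @ u) = f u" if "r \<le> length u" "y @ u \<in> reduced_words A" for y u
    using that(2)
  proof (induction y)
    case (Cons p y)
    then have "y @ u \<in> reduced_words A" "fst p \<in> A" "letter_act p (y @ u) = p # y @ u"
      by (auto simp: reduced_words_def reduced_Cons letter_act_Cons)
    then show ?case
      using Cons.IH r[of p "y @ u"] that(1) by simp
  qed simp
  have ends: "\<exists>t. F u t" if "u \<in> reduced_words A" "u \<noteq> []" for u
    using that
  proof (induction "r - length u" arbitrary: u rule: less_induct)
    case less
    show ?case
    proof (cases "r \<le> length u")
      case True
      then show ?thesis
        using beyond by (auto simp: F_def)
    next
      case False
      \<comment> \<open>\<open>a\<close> points from \<open>u\<close> towards the root, and all
        other letters lead to children of \<open>u\<close>. The edges avoiding \<open>a\<close> are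
        the axes with both branches beyond \<open>u\<close>.\<close>
      define a where "a = letter_inv (hd u)"
      have a: "fst a \<in> A" using less.prems by (cases u) (auto simp: a_def reduced_words_def)
      have child: "p # u \<in> reduced_words A \<longleftrightarrow> p \<in> ?L - {a}" for p
        using less.prems by (cases p) (auto simp: reduced_words_def reduced_Cons_iff a_def)
      have "\<exists>t. F (p # u) t" if "p \<in> ?L - {a}" for p
        using less.hyps[of "p # u"] False child that by auto
      then obtain t where t: "\<And>p. p \<in> ?L - {a} \<Longrightarrow> F (p # u) (t p)"
        by metis
      \<comment> \<open>The inverse of \<open>a\<close> is the first letter of \<open>u\<close>;
        repeating it never cancels, so it always gives a child.\<close>
      define t0 where "t0 = t (letter_inv a)"
      have "{p \<in> ?L - {a}. t p = t0} = ?L - {a}"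
      proof (rule conn1[OF a])
        show "{p \<in> ?L - {a}. t p = t0} \<noteq> {}"
          using a by (auto simp: t0_def intro!: exI[of _ "fst a"] exI[of _ "\<not> snd a"] simp: letter_inv_def prod_eq_iff)
        show "p \<in> {p \<in> ?L - {a}. t p = t0} \<longleftrightarrow> q \<in> {p \<in> ?L - {a}. t p = t0}"
          if "j < ?n" "p = v ! j" "q = letter_inv (v ! (Suc j mod ?n))" "p \<noteq> a" "q \<noteq> a" for j p q
        proof -
          have "Suc j mod ?n < ?n"
            by (rule mod_less_divisor) (use that(1) in linarith)
          then have "fst p \<in> A" "fst q \<in> A"
            using that by (auto simp: A_def)
          then have L: "p \<in> ?L - {a}" "q \<in> ?L - {a}"
            using that by (auto simp: mem_Times_iff)
          then have "t p = t q"
            using line[OF that(1-3)] child t less.prems(2) by blast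
          then show ?thesis using L by simp
        qed
      qed auto
      then have t0: "F (p # u) t0" if "p \<in> ?L - {a}" for p
        using t[OF that] that by auto
      then obtain M where M: "\<And>p y. p \<in> ?L - {a} \<Longrightarrow> length y \<ge> M p \<Longrightarrow>
          y @ p # u \<in> reduced_words A \<Longrightarrow> f (y @ p # u) = t0"
        unfolding F_def by metis
      define M0 where "M0 = Suc (Max (insert 0 (M ` ?L)))"
      have "f (y @ u) = t0" if y: "length y \<ge> M0" "y @ u \<in> reduced_words A" for y
      proof -
        obtain y' p where y': "y = y' @ [p]"
          using y(1) by (cases y rule: rev_cases) (auto simp: M0_def)
        have "p # u \<in> reduced_words A"
          using y(2) reduced_append_right[of y' "p # u"] by (auto simp: y' reduced_words_def)
        then have p: "p \<in> ?L - {a}" using child by simp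
        then have "M p \<le> Max (insert 0 (M ` ?L))"
          using L by (intro Max_ge) auto
        then have "M p \<le> length y'"
          using y(1) by (simp add: y' M0_def)
        then show ?thesis
          using M[OF p] y(2) by (simp add: y')
      qed
      then show ?thesis
        unfolding F_def by blast
    qed
  qed
  have single: "[p] \<in> reduced_words A \<longleftrightarrow> p \<in> ?L" for p
    by (cases p) (auto simp: reduced_words_def reduced_def)
  have "\<exists>t. F [p] t" if "p \<in> ?L" for p
    using ends[of "[p]"] single that by simp
  then obtain t where t: "\<And>p. p \<in> ?L \<Longrightarrow> F [p] (t p)"
    by metis
  let ?j = "?n - 1"
  have j: "?j < ?n" "Suc ?j = ?n" using v by auto
  have mem: "v ! j \<in> ?L" "letter_inv (v ! j) \<in> ?L" if "j < ?n" for j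
    using that by (auto simp: A_def mem_Times_iff)
  \<comment> \<open>At the root every letter gives a child. The edge from the last letter of
    \<open>v\<close> to the first belongs to the axis with the jump, hence the connectivity
    \<open>conn2\<close> without that edge.\<close>
  have "{p \<in> ?L. t p = t (v ! ?j)} = ?L"
  proof (rule conn2)
    show "{p \<in> ?L. t p = t (v ! ?j)} \<noteq> {}"
      using mem j by blast
    show "v ! j \<in> {p \<in> ?L. t p = t (v ! ?j)} \<longleftrightarrow> letter_inv (v ! Suc j) \<in> {p \<in> ?L. t p = t (v ! ?j)}"
      if "Suc j < ?n" for j
    proof -
      have "j < ?n" using that by simp
      then have "t (v ! j) = t (letter_inv (v ! Suc j))"
        using line[OF _ refl refl, of j "[]"] that mem single t by simp
      then show ?thesis using mem that \<open>j < ?n\<close> by auto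
    qed
  qed auto
  then have eq: "t (letter_inv (v ! 0)) = t (v ! ?j)"
    using mem(2)[of 0] v(1) by (metis (mono_tags, lifting) length_greater_0_conv mem_Collect_eq)
  obtain M where M: "\<And>y. length y \<ge> M \<Longrightarrow> y @ [v ! ?j] \<in> reduced_words A \<Longrightarrow> f (y @ [v ! ?j]) = t (v ! ?j)"
    using t[of "v ! ?j"] mem j(1) unfolding F_def by blast
  obtain M' where M': "\<And>y. length y \<ge> M' \<Longrightarrow> y @ [letter_inv (v ! 0)] \<in> reduced_words A \<Longrightarrow>
      f (y @ [letter_inv (v ! 0)]) = t (letter_inv (v ! 0))"
    using t[of "letter_inv (v ! 0)"] mem[of 0] v(1) unfolding F_def by blast
  have q: "letter_inv (v ! 0) = letter_inv (v ! (Suc ?j mod ?n))"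
    using j by simp
  have ends: "[v ! ?j] \<in> reduced_words A" "[letter_inv (v ! 0)] \<in> reduced_words A"
    unfolding single using mem[OF j(1)] mem(2)[of 0] v(1) by blast+
  \<comment> \<open>The two ends of the exceptional axis carry the values \<open>f v\<close> and
    \<open>f []\<close>, which \<open>eq\<close> forces to agree.\<close>
  obtain y z where "max M M' \<le> length y" "max M M' \<le> length z" "y @ [v ! ?j] \<in> reduced_words A"
    "z @ [letter_inv (v ! 0)] \<in> reduced_words A" "f (y @ [v ! ?j]) = f v"
    "f (z @ [letter_inv (v ! 0)]) = f []"
    by (rule axis_values[where v = v and f = f and u = "[]" and m = "max M M'" and j = ?j
          and p = "v ! ?j" and q = "letter_inv (v ! 0)", folded A_def, OF v(2) f(1) j(1) refl q ends])
      (use j(2) in blast)+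
  then show False
    using M[of y] M'[of z] f(2) eq by simp
qed

section \<open>Words of minimal length\<close>

definition basis_word :: "('a, 'm) monoid_scheme \<Rightarrow> 'a \<Rightarrow> 'a set \<Rightarrow> 'a word \<Rightarrow> bool" where
  "basis_word G w B v \<longleftrightarrow> free_basis G B \<and> fst ` set v \<subseteq> B \<and> word_eval G v = w"

definition minimal_word :: "('a, 'm) monoid_scheme \<Rightarrow> 'a \<Rightarrow> 'a set \<Rightarrow> 'a word \<Rightarrow> bool" where
  "minimal_word G w B v \<longleftrightarrow>
    basis_word G w B v \<and> (\<forall>B' v'. basis_word G w B' v' \<longrightarrow> length v \<le> length v')"

lemma ex_minimal_word:
  assumes "group G" "free_basis G X" "w \<in> carrier G"
  obtains B v where "minimal_word G w B v"
proof -
  obtain u where "basis_word G w X u"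
    using free_basis_word[OF assms] assms(2) unfolding basis_word_def by metis
  then obtain x where "basis_word G w (fst x) (snd x)"
    "\<forall>y. basis_word G w (fst y) (snd y) \<longrightarrow> length (snd x) \<le> length (snd y)"
    using ex_has_least_nat[of "\<lambda>x. basis_word G w (fst x) (snd x)" "(X, u)" "\<lambda>x. length (snd x)"]
    by auto
  then show thesis
    by (intro that[of "fst x" "snd x"]) (simp add: minimal_word_def)
qed

text \<open>Minimality ranges over all free bases, so an automorphism can move the basis instead of
  the element: applying \<open>\<psi>\<close> to a word for \<open>\<beta> w\<close> over
  \<open>B\<close> gives an equally long word for \<open>w\<close> over the image of
  \<open>B\<close>.\<close>

lemma (in group) minimal_word_le:
  assumes v: "minimal_word G w B v"
    and \<psi>: "\<psi> \<in> hom G G" "\<beta> \<in> hom G G" "\<And>g. g \<in> carrier G \<Longrightarrow> \<beta> (\<psi> g) = g"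
      "\<And>g. g \<in> carrier G \<Longrightarrow> \<psi> (\<beta> g) = g"
    and u: "fst ` set u \<subseteq> B" "word_eval G u = \<beta> w"
  shows "length v \<le> length u"
proof -
  have B: "free_basis G B" "B \<subseteq> carrier G" and w: "w \<in> carrier G"
    using v by (auto simp: minimal_word_def basis_word_def free_basis_def intro!: word_eval_closed)
  have "word_eval G (map (apfst \<psi>) u) = \<psi> (word_eval G u)"
    using u(1) B(2) by (intro hom_word_eval[symmetric] group_axioms \<psi>) auto
  also have "\<dots> = w" using u w \<psi> by simp
  finally have "basis_word G w (\<psi> ` B) (map (apfst \<psi>) u)"
    unfolding basis_word_def using free_basis_automorphism[OF group_axioms B(1) \<psi>] u(1) by auto
  then show ?thesis
    using v unfolding minimal_word_def by (metis length_map)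
qed

lemma (in group) mult_inv_cancel:
  assumes "x \<in> carrier G" "y \<in> carrier G"
  shows "x \<otimes> (inv x \<otimes> y) = y" "inv x \<otimes> (x \<otimes> y) = y"
  using assms by (simp_all flip: m_assoc)

lemma hom_compose_fun: "f \<in> hom G H \<Longrightarrow> g \<in> hom H K \<Longrightarrow> (\<lambda>x. g (f x)) \<in> hom G K"
  by (auto simp: hom_def Pi_iff)

lemma (in group) conj_hom: "c \<in> carrier G \<Longrightarrow> (\<lambda>g. c \<otimes> g \<otimes> inv c) \<in> hom G G"
  by (rule homI) (simp_all add: m_assoc mult_inv_cancel)

lemma (in group) minimal_word_cyclically_reduced:
  assumes v: "minimal_word G w B v"
  shows "cyclically_reduced v"
  unfolding cyclically_reduced_def
proof (intro allI impI notI)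
  have B: "B \<subseteq> carrier G" "fst ` set v \<subseteq> B" "word_eval G v = w"
    using v by (auto simp: minimal_word_def basis_word_def free_basis_def)
  fix j assume j: "j < length v" and c: "v ! (Suc j mod length v) = letter_inv (v ! j)"
  define p where "p = v ! j"
  have p: "fst p \<in> B" using B(2) j by (auto simp: p_def)
  then have pc: "fst p \<in> carrier G" using B by auto
  show False
  proof (cases "Suc j = length v")
    case False
    then have j': "Suc j < length v" using j by simp
    let ?u = "take j v @ drop (Suc (Suc j)) v"
    let ?t = "take j v" and ?d = "drop (Suc (Suc j)) v"
    have v': "v = ?t @ p # letter_inv p # ?d"
      using id_take_nth_drop[OF j] Cons_nth_drop_Suc[OF j'] c j' by (simp add: p_def)
    have sub: "fst ` set ?t \<subseteq> B" "fst ` set ?d \<subseteq> B"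
      using B(2) set_take_subset[of j v] set_drop_subset[of "Suc (Suc j)" v] by blast+
    then have subc: "fst ` set ?t \<subseteq> carrier G" "fst ` set ?d \<subseteq> carrier G"
      using B(1) by blast+
    have "word_eval G (?t @ p # letter_inv p # ?d) = word_eval G ?u"
      using subc pc word_eval_closed[OF subc(1)] word_eval_closed[OF subc(2)] letter_eval_closed[OF pc]
      by (simp add: word_eval_append letter_eval_inv mult_inv_cancel)
    then have "word_eval G ?u = w"
      using v' B(3) by simp
    then have "basis_word G w B ?u"
      using v sub by (simp add: minimal_word_def basis_word_def image_Un)
    then have "length v \<le> length ?u"
      using v unfolding minimal_word_def by blast
    then show False using j' by simp
  next
    case True
    then have v0: "v ! 0 = letter_inv p" using c by (simp add: p_def)
    moreover have "v \<noteq> []" using j by auto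
    ultimately have "v = letter_inv p # tl v"
      by (cases v) auto
    moreover have "last v = p"
      using True \<open>v \<noteq> []\<close> by (metis p_def diff_Suc_1 last_conv_nth)
    moreover have "tl v \<noteq> []"
      using calculation by (metis last_ConsL letter_inv_neq(1))
    \<comment> \<open>Here the cancellation is between the two ends of \<open>v\<close>: an inner
      automorphism turns \<open>w\<close> into the value of the shorter word
      \<open>m\<close>.\<close>
    ultimately obtain m where m: "v = letter_inv p # m @ [p]"
      by (metis append_butlast_last_id last_tl)
    have mB: "fst ` set m \<subseteq> B" using B(2) by (auto simp: m)
    let ?c = "letter_eval G (letter_inv p)"
    have cc: "?c \<in> carrier G" "word_eval G m \<in> carrier G"
      using pc mB B by (auto simp: letter_eval_closed word_eval_closed)
    have "w = ?c \<otimes> (word_eval G m \<otimes> inv ?c)"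
      using B(3) mB B(1) pc unfolding m
      by (simp add: word_eval_append letter_eval_inv letter_eval_closed)
    then have "word_eval G m = inv ?c \<otimes> w \<otimes> inv (inv ?c)"
      using cc by (simp add: m_assoc mult_inv_cancel)
    then have "length v \<le> length m"
      using minimal_word_le[OF v conj_hom[OF cc(1)] conj_hom[of "inv ?c"] _ _ mB]
        cc(1) by (simp add: m_assoc mult_inv_cancel)
    then show False by (simp add: m)
  qed
qed

section \<open>Whitehead automorphisms\<close>

text \<open>With \<open>s\<close> the indicator of \<open>Z\<close>, the Whitehead automorphism rewrites each letter \<open>l\<close> as
  \<open>a^(- s (letter_inv l)) l' a^(s l)\<close>, where \<open>l' = l\<close> except that
  \<open>l' = 1\<close> for \<open>l = a\<close> and its inverse. Below, the leading power of \<open>a\<close> is omitted and \<open>z\<close> is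
  the letter that follows the word cyclically.\<close>

fun whitehead_word :: "'a \<times> bool \<Rightarrow> ('a \<times> bool) set \<Rightarrow> 'a word \<Rightarrow> 'a \<times> bool \<Rightarrow> 'a word" where
  "whitehead_word a Z [] z = []"
| "whitehead_word a Z (l # v) z =
    (if fst l = fst a then [] else [l]) @
    (let l' = letter_inv (hd (v @ [z])) in
      if l \<in> Z \<and> l' \<notin> Z then [a] else if l \<notin> Z \<and> l' \<in> Z then [letter_inv a] else []) @
    whitehead_word a Z v z"

lemma set_whitehead_word: "fst ` set (whitehead_word a Z v z) \<subseteq> insert (fst a) (fst ` set v)"
  by (induction v) (auto simp: Let_def)

lemma length_whitehead_word:
  "length (whitehead_word a Z v z) = (\<Sum>j<length v. of_bool (fst (v ! j) \<noteq> fst a) +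
    of_bool ((v ! j \<in> Z) \<noteq> (letter_inv ((v @ [z]) ! Suc j) \<in> Z)))"
proof (induction v)
  case (Cons l v)
  show ?case
    unfolding list.size(4) One_nat_def add_Suc_right add_0_right sum.lessThan_Suc_shift
    using Cons by (simp add: Let_def hd_conv_nth)
qed simp

text \<open>The left-hand side is the degree of \<open>a\<close> in the Whitehead graph, the
  right-hand side the number of edges leaving \<open>Z\<close>. The Whitehead automorphism deletes
  every occurrence of \<open>a\<close> and its inverse and inserts one such letter for each edge
  leaving \<open>Z\<close>, so a smaller cut would shorten the word.\<close>

lemma (in group) whitehead_minimal:
  assumes v: "minimal_word G w B v" "v \<noteq> []"
    and a: "fst a \<in> B" "a \<in> Z" "letter_inv a \<notin> Z"
  shows "(\<Sum>j<length v. of_bool (fst (v ! j) = fst a)) \<le> (\<Sum>j<length v.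
    of_bool ((v ! j \<in> Z) \<noteq> (letter_inv (v ! (Suc j mod length v)) \<in> Z)) :: nat)"
proof -
  have B: "free_basis G B" "B \<subseteq> carrier G" "fst ` set v \<subseteq> B" "word_eval G v = w"
    using v by (auto simp: minimal_word_def basis_word_def free_basis_def)
  define \<alpha> where "\<alpha> = letter_eval G a"
  have \<alpha>: "\<alpha> \<in> carrier G" using a B by (auto simp: \<alpha>_def intro: letter_eval_closed)
  define s where "s l = (if l \<in> Z then \<alpha> else \<one>)" for l
  have s: "s l \<in> carrier G" for l using \<alpha> by (simp add: s_def)
  have xc: "x \<in> carrier G" if "x \<in> B" for x using that B by auto
  obtain \<beta> where \<beta>: "\<beta> \<in> hom G G" "\<And>x. x \<in> B \<Longrightarrow> \<beta> x =
      (if x = fst a then x else inv (s (x, False)) \<otimes> x \<otimes> s (x, True))"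
    by (rule free_basis_hom[OF group_axioms group_axioms B(1),
          of "\<lambda>x. if x = fst a then x else inv (s (x, False)) \<otimes> x \<otimes> s (x, True)"])
       (auto simp: s xc)
  \<comment> \<open>\<open>\<psi>\<close> will invert \<open>\<beta>\<close>: both fix
    \<open>\<alpha>\<close>, hence all values of \<open>s\<close>, so the inserted factors
    cancel.\<close>
  obtain \<psi> where \<psi>: "\<psi> \<in> hom G G" "\<And>x. x \<in> B \<Longrightarrow> \<psi> x =
      (if x = fst a then x else s (x, False) \<otimes> x \<otimes> inv (s (x, True)))"
    by (rule free_basis_hom[OF group_axioms group_axioms B(1),
          of "\<lambda>x. if x = fst a then x else s (x, False) \<otimes> x \<otimes> inv (s (x, True))"])
       (auto simp: s xc)
  interpret \<beta>: group_hom G G \<beta>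
    using \<beta> by (simp add: group_hom_def group_hom_axioms_def group_axioms)
  interpret \<psi>: group_hom G G \<psi>
    using \<psi> by (simp add: group_hom_def group_hom_axioms_def group_axioms)
  have \<beta>\<alpha>: "\<beta> \<alpha> = \<alpha>" and \<psi>\<alpha>: "\<psi> \<alpha> = \<alpha>"
    using a \<beta>(2) \<psi>(2) xc by (auto simp: \<alpha>_def letter_eval_def)
  have \<beta>s: "\<beta> (s l) = s l" and \<psi>s: "\<psi> (s l) = s l" for l
    by (auto simp: s_def \<beta>\<alpha> \<psi>\<alpha>)
  have id: "(\<lambda>g. g) \<in> hom G G" by (rule homI) auto
  have \<beta>\<psi>: "\<beta> (\<psi> g) = g" if "g \<in> carrier G" for g
  proof (rule free_basis_hom_eq[OF group_axioms group_axioms B(1) _ id])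
    show "(\<lambda>g. \<beta> (\<psi> g)) \<in> hom G G"
      by (rule hom_compose_fun[OF \<psi>(1) \<beta>(1)])
    show "\<beta> (\<psi> b) = b" if "b \<in> B" for b
      using that s xc by (cases "b = fst a") (simp_all add: \<psi>(2) \<beta>(2) \<beta>s m_assoc mult_inv_cancel)
  qed fact
  have \<psi>\<beta>: "\<psi> (\<beta> g) = g" if "g \<in> carrier G" for g
  proof (rule free_basis_hom_eq[OF group_axioms group_axioms B(1) _ id])
    show "(\<lambda>g. \<psi> (\<beta> g)) \<in> hom G G"
      by (rule hom_compose_fun[OF \<beta>(1) \<psi>(1)])
    show "\<psi> (\<beta> b) = b" if "b \<in> B" for b
      using that s xc by (cases "b = fst a") (simp_all add: \<psi>(2) \<beta>(2) \<psi>s m_assoc mult_inv_cancel)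
  qed fact
  \<comment> \<open>Hence between a letter \<open>l\<close> and the next letter \<open>l2\<close>
    only \<open>s l\<close> times the inverse of \<open>s (letter_inv l2)\<close> remains, a power
    of \<open>a\<close> with exponent -1, 0 or 1.\<close>
  have letter: "s (letter_inv l) \<otimes> \<beta> (letter_eval G l) =
      (if fst l = fst a then \<one> else letter_eval G l) \<otimes> s l" if l: "fst l \<in> B" for l
  proof (cases "fst l = fst a")
    case True
    have "\<beta> (letter_eval G l) = letter_eval G l"
      using True l xc by (simp add: letter_eval_def \<beta>(2))
    moreover have "letter_eval G (letter_inv a) = inv \<alpha>"
      using a xc by (simp add: \<alpha>_def letter_eval_inv)
    ultimately show ?thesis
      using letter_eq_or_inv[OF True] a \<alpha> by (auto simp: s_def \<alpha>_def)
  next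
    case False
    obtain x b where xb: "l = (x, b)" by (cases l)
    have x: "x \<in> carrier G" "x \<in> B" using l xc by (auto simp: xb)
    show ?thesis
      using False x s unfolding xb letter_inv_def letter_eval_def
      by (cases b) (simp_all add: \<beta>(2) inv_mult_group m_assoc mult_inv_cancel \<beta>s)
  qed
  have append3: "word_eval G (x @ y @ z) = word_eval G x \<otimes> (word_eval G y \<otimes> word_eval G z)"
    if "fst ` set x \<subseteq> carrier G" "fst ` set y \<subseteq> carrier G" "fst ` set z \<subseteq> carrier G" for x y z
    using that by (simp add: word_eval_append image_Un)
  have cancel: "m \<otimes> (x \<otimes> inv y \<otimes> (y \<otimes> g \<otimes> t)) = m \<otimes> x \<otimes> g \<otimes> t"
    if "m \<in> carrier G" "x \<in> carrier G" "y \<in> carrier G" "g \<in> carrier G" "t \<in> carrier G" for m x y g t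
    using that by (simp add: m_assoc mult_inv_cancel)
  have word: "word_eval G (whitehead_word a Z u z) =
      s (letter_inv (hd (u @ [z]))) \<otimes> \<beta> (word_eval G u) \<otimes> inv (s (letter_inv z))"
    if "fst ` set u \<subseteq> B" for u z
    using that
  proof (induction u)
    case Nil
    then show ?case using s by simp
  next
    case (Cons l u)
    let ?h = "letter_inv (hd (u @ [z]))" and ?m = "if fst l = fst a then [] else [l]"
    let ?g = "if l \<in> Z \<and> ?h \<notin> Z then [a] else if l \<notin> Z \<and> ?h \<in> Z then [letter_inv a] else []"
    have l: "fst l \<in> B" and u: "fst ` set u \<subseteq> B" using Cons.prems by auto
    have uc: "word_eval G u \<in> carrier G" "letter_eval G l \<in> carrier G"
      using u B l by (auto intro!: word_eval_closed letter_eval_closed)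
    have g: "word_eval G ?g = s l \<otimes> inv (s ?h)"
      using \<alpha> a xc by (simp add: s_def letter_eval_inv flip: \<alpha>_def)
    have m: "word_eval G ?m = (if fst l = fst a then \<one> else letter_eval G l)"
      using uc by simp
    have mc: "word_eval G ?m \<in> carrier G" using uc by simp
    have "fst ` set ?m \<subseteq> carrier G" "fst ` set ?g \<subseteq> carrier G"
      using l a xc by auto
    moreover have "fst ` set (whitehead_word a Z u z) \<subseteq> carrier G"
    proof -
      have "insert (fst a) (fst ` set u) \<subseteq> carrier G"
        using a(1) u B(2) by auto
      with set_whitehead_word show ?thesis by (rule subset_trans)
    qed
    ultimately have "word_eval G (whitehead_word a Z (l # u) z) =
        word_eval G ?m \<otimes> (word_eval G ?g \<otimes> word_eval G (whitehead_word a Z u z))"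
      unfolding whitehead_word.simps Let_def by (rule append3)
    also have "\<dots> = word_eval G ?m \<otimes> s l \<otimes> \<beta> (word_eval G u) \<otimes> inv (s (letter_inv z))"
      unfolding g Cons.IH[OF u] 
      by (rule cancel[OF mc s s \<beta>.hom_closed[OF uc(1)] inv_closed[OF s]])
    also have "word_eval G ?m \<otimes> s l = s (letter_inv l) \<otimes> \<beta> (letter_eval G l)"
      using letter[OF l] m by simp
    finally show ?case
      using s uc by (simp add: m_assoc)
  qed
  define c where "c = s (letter_inv (hd v))"
  have c: "c \<in> carrier G" by (simp add: c_def s)
  let ?u = "whitehead_word a Z v (hd v)"
  have uB: "fst ` set ?u \<subseteq> B"
    by (rule subset_trans[OF set_whitehead_word]) (use a(1) B(3) in simp)
  have wc: "w \<in> carrier G" using B by (auto intro!: word_eval_closed)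
  \<comment> \<open>With \<open>hd v\<close> as the following letter the word closes up cyclically:
    the missing first and last factors are inverse to each other and amount to conjugation by
    \<open>c\<close>.\<close>
  have "word_eval G ?u = c \<otimes> \<beta> w \<otimes> inv c"
    using word[OF B(3), of "hd v"] v(2) by (simp add: c_def B(4))
  moreover have "(\<lambda>g. c \<otimes> \<beta> g \<otimes> inv c) \<in> hom G G"
    by (rule hom_compose_fun[OF \<beta>(1) conj_hom[OF c]])
  moreover have "(\<lambda>g. \<psi> (inv c \<otimes> g \<otimes> c)) \<in> hom G G"
    using hom_compose_fun[OF conj_hom[of "inv c"] \<psi>(1)] c by simp
  ultimately have "length v \<le> length ?u"
    using c by (intro minimal_word_le[OF v(1), of "\<lambda>g. \<psi> (inv c \<otimes> g \<otimes> c)" "\<lambda>g. c \<otimes> \<beta> g \<otimes> inv c"])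
      (simp_all add: \<beta>\<psi> \<psi>\<beta> uB m_assoc mult_inv_cancel)
  moreover have "(v @ [hd v]) ! Suc j = v ! (Suc j mod length v)" if "j < length v" for j
    using that v(2) by (cases "Suc j = length v") (auto simp: nth_append hd_conv_nth)
  moreover have "length v = (\<Sum>j<length v. of_bool (fst (v ! j) = fst a)) +
      (\<Sum>j<length v. of_bool (fst (v ! j) \<noteq> fst a))"
  proof -
    have "length v = (\<Sum>j<length v. 1)" by simp
    also have "\<dots> = (\<Sum>j<length v. of_bool (fst (v ! j) = fst a) + of_bool (fst (v ! j) \<noteq> fst a))"
      by (rule sum.cong) auto
    finally show ?thesis unfolding sum.distrib .
  qed
  ultimately show ?thesis
    unfolding length_whitehead_word sum.distrib by simp
qed

section \<open>Connectivity of the Whitehead graph\<close>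

lemma sum_cyclic_shift:
  fixes f :: "nat \<Rightarrow> 'b :: comm_monoid_add"
  shows "(\<Sum>j<n. f (Suc j mod n)) = (\<Sum>j<n. f j)"
proof (cases n)
  case (Suc m)
  have "(\<Sum>j<m. f (Suc j mod Suc m)) = (\<Sum>j<m. f (Suc j))"
    by (intro sum.cong) auto
  then have "(\<Sum>j<Suc m. f (Suc j mod Suc m)) = (\<Sum>j<m. f (Suc j)) + f 0"
    by simp
  also have "\<dots> = (\<Sum>j<Suc m. f j)"
    unfolding sum.lessThan_Suc_shift by (simp add: add.commute)
  finally show ?thesis by (simp add: Suc)
qed simp

context group
begin

text \<open>This is connectedness. If \<open>S\<close> contained a letter without its inverse, it
  would be a cut with no edges, and by \<open>whitehead_minimal\<close> the letter would not occur.
  So \<open>S\<close> is closed under inverses, and the edges carry membership along the whole of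
  \<open>v\<close>.\<close>

lemma minimal_word_edge_closed:
  assumes v: "minimal_word G w B v" "v \<noteq> []"
    and S: "S \<subseteq> fst ` set v \<times> UNIV" "S \<noteq> {}"
    and closed: "\<And>j. j < length v \<Longrightarrow> v ! j \<in> S \<longleftrightarrow> letter_inv (v ! (Suc j mod length v)) \<in> S"
  shows "S = fst ` set v \<times> UNIV"
proof -
  let ?n = "length v"
  have inv: "letter_inv b \<in> S" if b: "b \<in> S" for b
  proof (rule ccontr)
    assume "letter_inv b \<notin> S"
    moreover have "fst b \<in> B"
    proof -
      have "fst b \<in> fst ` set v" using subsetD[OF S(1) b] by (simp add: mem_Times_iff)
      then show ?thesis using v(1) by (auto simp: minimal_word_def basis_word_def)
    qed
    ultimately have "(\<Sum>j<?n. of_bool (fst (v ! j) = fst b)) \<le> (0 :: nat)"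
      using whitehead_minimal[OF v, of b S] b closed by simp
    then have "fst (v ! j) \<noteq> fst b" if "j < ?n" for j
      using that by auto
    moreover have "fst b \<in> fst ` set v"
      using subsetD[OF S(1) b] by (simp add: mem_Times_iff)
    ultimately show False by (metis (no_types, lifting) imageE in_set_conv_nth)
  qed
  have fst_S: "p \<in> S" if "b \<in> S" "fst p = fst b" for p b
    using that letter_eq_or_inv[of p b] inv by metis
  have step: "v ! Suc j \<in> S \<longleftrightarrow> v ! j \<in> S" if "Suc j < ?n" for j
    using closed[of j] that fst_S by (metis Suc_lessD fst_letter_inv mod_less)
  have all: "v ! j \<in> S \<longleftrightarrow> v ! 0 \<in> S" if "j < ?n" for j
    using that by (induction j) (auto simp: step)
  obtain b where b: "b \<in> S" using S by auto
  then obtain i where "i < ?n" "fst (v ! i) = fst b"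
    using subsetD[OF S(1) b] by (auto simp: mem_Times_iff in_set_conv_nth)
  then have "v ! 0 \<in> S" using fst_S[OF b] all by blast
  then have mem: "p \<in> S" if "fst p \<in> fst ` set v" for p
    using that all fst_S by (metis (no_types, lifting) imageE in_set_conv_nth)
  show ?thesis
    by (rule equalityI[OF S(1)], rule subsetI, rule mem) (simp add: mem_Times_iff)
qed

text \<open>Only edges at \<open>a\<close> can leave \<open>insert a S\<close>, and
  \<open>whitehead_minimal\<close> forces all of them to do so. Thus no edge joins \<open>a\<close>
  to \<open>S\<close>, and \<open>S\<close> contradicts connectedness.\<close>

lemma minimal_word_no_cut_vertex_aux:
  assumes v: "minimal_word G w B v" "v \<noteq> []"
    and a: "fst a \<in> fst ` set v"
    and S: "S \<subseteq> fst ` set v \<times> UNIV - {a}" "S \<noteq> {}" "letter_inv a \<notin> S"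
    and closed: "\<And>j p q. j < length v \<Longrightarrow> p = v ! j \<Longrightarrow> q = letter_inv (v ! (Suc j mod length v)) \<Longrightarrow>
         p \<noteq> a \<Longrightarrow> q \<noteq> a \<Longrightarrow> p \<in> S \<longleftrightarrow> q \<in> S"
  shows False
proof -
  let ?n = "length v"
  let ?q = "\<lambda>j. letter_inv (v ! (Suc j mod ?n))"
  let ?cross = "\<lambda>j. of_bool ((v ! j \<in> insert a S) \<noteq> (?q j \<in> insert a S)) :: nat"
  let ?deg = "\<lambda>j. of_bool (v ! j = a) + of_bool (?q j = a) :: nat"
  have aB: "fst a \<in> B"
    using a v by (auto simp: minimal_word_def basis_word_def)
  have le: "?cross j \<le> ?deg j" if "j < ?n" for j
    using closed[OF that refl refl] by auto
  have "(\<Sum>j<?n. ?deg j) = (\<Sum>j<?n. of_bool (v ! j = a)) + (\<Sum>j<?n. of_bool (letter_inv (v ! j) = a))"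
    using sum_cyclic_shift[of "\<lambda>j. of_bool (letter_inv (v ! j) = a) :: nat" ?n]
    by (simp only: sum.distrib)
  also have "\<dots> = (\<Sum>j<?n. of_bool (fst (v ! j) = fst a))"
    unfolding sum.distrib[symmetric]
  proof (rule sum.cong)
    show "of_bool (v ! j = a) + of_bool (letter_inv (v ! j) = a) = (of_bool (fst (v ! j) = fst a) :: nat)"
      for j
      using letter_eq_or_inv[of "v ! j" a] letter_inv_neq by (auto simp: of_bool_def)
  qed simp
  also have "\<dots> \<le> (\<Sum>j<?n. ?cross j)"
    by (rule whitehead_minimal[OF v aB]) (use S letter_inv_neq[of a] in auto)
  finally have "(\<Sum>j<?n. ?cross j) = (\<Sum>j<?n. ?deg j)"
    using sum_mono[of "{..<?n}" ?cross ?deg] le by (intro antisym) auto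
  then have eq: "?cross j = ?deg j" if "j < ?n" for j
    using sum_mono_inv[of ?cross "{..<?n}" ?deg j] le that by auto
  have "v ! j \<in> S \<longleftrightarrow> ?q j \<in> S" if j: "j < ?n" for j
    using eq[OF j] closed[OF j refl refl] S(1)
    by (cases "v ! j = a"; cases "?q j = a") (auto split: if_splits simp: of_bool_def)
  then have "S = fst ` set v \<times> UNIV"
    using S by (intro minimal_word_edge_closed[OF v]) auto
  then show False
    using S a by (auto simp: mem_Times_iff)
qed

lemma letter_nth_mem:
  assumes "v \<noteq> []" "j < length v"
  shows "v ! j \<in> fst ` set v \<times> UNIV" "letter_inv (v ! (Suc j mod length v)) \<in> fst ` set v \<times> UNIV"
  using assms by (auto simp: mem_Times_iff)

text \<open>\<open>S\<close> and its complement among the letters other than \<open>a\<close> are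
  both closed; one of them omits the inverse of \<open>a\<close>, as the auxiliary lemma
  requires.\<close>

lemma minimal_word_no_cut_vertex:
  assumes v: "minimal_word G w B v" "v \<noteq> []"
    and a: "fst a \<in> fst ` set v"
    and S: "S \<subseteq> fst ` set v \<times> UNIV - {a}" "S \<noteq> {}"
    and closed: "\<And>j p q. j < length v \<Longrightarrow> p = v ! j \<Longrightarrow> q = letter_inv (v ! (Suc j mod length v)) \<Longrightarrow>
         p \<noteq> a \<Longrightarrow> q \<noteq> a \<Longrightarrow> p \<in> S \<longleftrightarrow> q \<in> S"
  shows "S = fst ` set v \<times> UNIV - {a}"
proof (rule ccontr)
  let ?L = "fst ` set v \<times> (UNIV :: bool set)"
  assume ne: "S \<noteq> ?L - {a}"
  have mem: "letter_inv a \<in> S"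
  proof (rule ccontr)
    assume "letter_inv a \<notin> S"
    then show False
      by (rule minimal_word_no_cut_vertex_aux[OF v a S]) (rule closed)
  qed
  have closed': "p \<in> ?L - {a} - S \<longleftrightarrow> q \<in> ?L - {a} - S"
    if "j < length v" "p = v ! j" "q = letter_inv (v ! (Suc j mod length v))" "p \<noteq> a" "q \<noteq> a" for j p q
    using closed[OF that] letter_nth_mem[OF v(2) that(1)] that by simp
  show False
    by (rule minimal_word_no_cut_vertex_aux[OF v a, of "?L - {a} - S"]) (use ne S mem closed' in blast)+
qed

lemma primitive_letter:
  assumes B: "free_basis G B" and l: "fst l \<in> B"
  shows "primitive G (letter_eval G l)"
proof (cases "snd l")
  case True
  then show ?thesis using assms by (auto simp: primitive_def letter_eval_def)
next
  case False
  have xc: "x \<in> carrier G" if "x \<in> B" for x using that B by (auto simp: free_basis_def)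
  obtain \<psi> where \<psi>: "\<psi> \<in> hom G G" "\<And>x. x \<in> B \<Longrightarrow> \<psi> x = (if x = fst l then inv x else x)"
    by (rule free_basis_hom[OF group_axioms group_axioms B, of "\<lambda>x. if x = fst l then inv x else x"])
       (auto simp: xc)
  interpret \<psi>: group_hom G G \<psi>
    using \<psi> by (simp add: group_hom_def group_hom_axioms_def group_axioms)
  have "\<psi> (\<psi> g) = g" if "g \<in> carrier G" for g
  proof (rule free_basis_hom_eq[OF group_axioms group_axioms B])
    show "(\<lambda>g. \<psi> (\<psi> g)) \<in> hom G G"
      by (rule hom_compose_fun[OF \<psi>(1) \<psi>(1)])
    show "(\<lambda>g. g) \<in> hom G G" by (rule homI) auto
    show "\<psi> (\<psi> b) = b" if "b \<in> B" for b
      using that xc by (cases "b = fst l") (auto simp: \<psi>(2))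
  qed fact
  then have "free_basis G (\<psi> ` B)"
    by (intro free_basis_automorphism[OF group_axioms B \<psi>(1) \<psi>(1)])
  moreover have "letter_eval G l \<in> \<psi> ` B"
    using l False \<psi>(2)[OF l] by (auto simp: letter_eval_def image_iff intro!: bexI[of _ "fst l"])
  ultimately show ?thesis by (auto simp: primitive_def)
qed

text \<open>An endpoint of a bridge would be a cut vertex unless it is alone on its side. So a
  bridge leaves only two vertices, inverse to each other, and then \<open>v\<close> is a single
  letter and \<open>w\<close> primitive.\<close>

lemma minimal_word_no_bridge:
  assumes v: "minimal_word G w B v" "v \<noteq> []" and w: "\<not> primitive G w"
    and S: "S \<subseteq> fst ` set v \<times> UNIV" "S \<noteq> {}"
    and closed: "\<And>j. Suc j < length v \<Longrightarrow> v ! j \<in> S \<longleftrightarrow> letter_inv (v ! Suc j) \<in> S"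
  shows "S = fst ` set v \<times> UNIV"
proof (rule ccontr)
  let ?L = "fst ` set v \<times> (UNIV :: bool set)" and ?n = "length v"
  assume ne: "S \<noteq> ?L"
  define p where "p = v ! (?n - 1)"
  define q where "q = letter_inv (v ! 0)"
  have edge: "(v ! j \<in> S \<longleftrightarrow> letter_inv (v ! (Suc j mod ?n)) \<in> S) \<or>
      (v ! j = p \<and> letter_inv (v ! (Suc j mod ?n)) = q)" if "j < ?n" for j
  proof (cases "Suc j = ?n")
    case True
    then show ?thesis by (simp add: p_def q_def flip: True)
  next
    case False
    then show ?thesis using closed[of j] that by simp
  qed
  have "\<not> (p \<in> S \<longleftrightarrow> q \<in> S)"
    using minimal_word_edge_closed[OF v S] edge ne by blast
  moreover have "p \<in> ?L" "q \<in> ?L"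
    unfolding p_def q_def using v(2) by (simp_all add: mem_Times_iff)
  ultimately obtain x y where xy: "{x, y} = {p, q}" "x \<in> S" "y \<in> ?L - S"
    by blast
  then have xy': "x = p \<and> y = q \<or> x = q \<and> y = p"
    by (simp add: doubleton_eq_iff)
  have fx: "fst x \<in> fst ` set v" "fst y \<in> fst ` set v"
    using subsetD[OF S(1) xy(2)] xy(3) by (simp_all add: mem_Times_iff)
  have "S - {x} = {}"
  proof (rule ccontr)
    assume "S - {x} \<noteq> {}"
    then have "S - {x} = ?L - {x}"
    proof (intro minimal_word_no_cut_vertex[OF v fx(1)])
      show "r \<in> S - {x} \<longleftrightarrow> t \<in> S - {x}"
        if "j < ?n" "r = v ! j" "t = letter_inv (v ! (Suc j mod ?n))" "r \<noteq> x" "t \<noteq> x" for j r t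
        using edge[OF that(1)] xy' that(2-5) by auto
    qed (use S in auto)
    then show False using xy by blast
  qed
  then have Sx: "S = {x}" using xy by blast
  have Sy: "S = ?L - {y}"
  proof (intro minimal_word_no_cut_vertex[OF v fx(2)])
    show "r \<in> S \<longleftrightarrow> t \<in> S"
      if "j < ?n" "r = v ! j" "t = letter_inv (v ! (Suc j mod ?n))" "r \<noteq> y" "t \<noteq> y" for j r t
      using edge[OF that(1)] xy' that(2-5) by auto
  qed (use S xy in auto)
  have "letter_inv x \<in> ?L"
    using fx by (simp add: mem_Times_iff)
  moreover have "letter_inv x \<notin> S"
    by (simp add: Sx)
  ultimately have y: "y = letter_inv x"
    using Sy by (metis DiffI singletonD)
  have L: "l = x \<or> l = letter_inv x" if "l \<in> set v" for l
  proof -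
    have "l \<in> ?L" using that by (simp add: mem_Times_iff)
    then show ?thesis using Sy Sx y by blast
  qed
  \<comment> \<open>A longer reduced word in one letter repeats it, and its first two positions give
    an edge between \<open>x\<close> and its inverse other than the bridge.\<close>
  have "?n = 1"
  proof (rule ccontr)
    assume "?n \<noteq> 1"
    moreover have "?n \<noteq> 0" using v(2) by simp
    ultimately have n: "Suc 0 < ?n" by linarith
    then have "v ! Suc 0 \<noteq> letter_inv (v ! 0)"
      using cyclically_reduced_imp_reduced[OF minimal_word_cyclically_reduced[OF v(1)]]
      unfolding reduced_nth by blast
    moreover have "v ! 0 = x \<longleftrightarrow> letter_inv (v ! Suc 0) = x"
      using closed[OF n] by (simp add: Sx)
    moreover have "v ! 0 \<in> set v" "v ! Suc 0 \<in> set v" using n by (auto intro!: nth_mem)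
    ultimately show False
      using L by (metis letter_inv_inv)
  qed
  then obtain l where l: "v = [l]"
    by (metis One_nat_def length_0_conv length_Suc_conv)
  then have B: "free_basis G B" "fst l \<in> B" "w = letter_eval G l \<otimes> \<one>"
    using v(1) by (auto simp: minimal_word_def basis_word_def)
  then have "w = letter_eval G l"
    by (auto simp: free_basis_def intro!: r_one letter_eval_closed)
  then show False
    using primitive_letter[OF B(1,2)] w by simp
qed

end

section \<open>Functionals with prescribed kernel\<close>

declare add_bit_eq_xor [simp del] mult_bit_eq_and [simp del]

lemma bit_add_self [simp]: "x + x = (0 :: bit)"
  by (cases x) auto

lemma bit_fun_add_self [simp]: "f + f = (0 :: 'b \<Rightarrow> bit)"
  by (simp add: fun_eq_iff)

lemma sum_fun_apply: "(\<Sum>i\<in>I. F i) x = (\<Sum>i\<in>I. F i x)"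
  by (induction I rule: infinite_finite_induct) auto

lemma exists_functional:
  fixes U :: "('b \<Rightarrow> bit) set"
  assumes U: "0 \<in> U" "\<And>f g. f \<in> U \<Longrightarrow> g \<in> U \<Longrightarrow> f + g \<in> U" and \<delta>: "\<delta> \<notin> U"
  obtains \<Lambda> :: "('b \<Rightarrow> bit) \<Rightarrow> bit" where
    "\<And>f g. \<Lambda> (f + g) = \<Lambda> f + \<Lambda> g" "\<And>f. f \<in> U \<Longrightarrow> \<Lambda> f = 0" "\<Lambda> \<delta> = 1"
proof -
  let ?s = "\<lambda>(c :: bit) (f :: 'b \<Rightarrow> bit) x. c * f x"
  interpret V: vector_space ?s
    by unfold_locales (auto simp: fun_eq_iff algebra_simps)
  interpret W: vector_space "(*) :: bit \<Rightarrow> bit \<Rightarrow> bit"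
    by unfold_locales (auto simp: algebra_simps)
  interpret VW: vector_space_pair ?s "(*) :: bit \<Rightarrow> bit \<Rightarrow> bit" ..
  have sub: "V.subspace U"
  proof (rule V.subspaceI)
    fix c :: bit and f assume "f \<in> U"
    then show "?s c f \<in> U"
      using U(1) by (cases c) (auto simp: zero_fun_def)
  qed (use U in auto)
  obtain B where B: "B \<subseteq> U" "V.independent B" "U \<subseteq> V.span B"
    by (rule V.maximal_independent_subset)
  have span: "V.span B = U"
    using B V.span_minimal[OF B(1) sub] by blast
  have ind: "V.independent (insert \<delta> B)"
    using B(2) \<delta> span by (simp add: V.independent_insert)
  obtain \<Lambda> where lin: "Vector_Spaces.linear ?s (*) \<Lambda>" and
    \<Lambda>: "\<forall>x\<in>insert \<delta> B. \<Lambda> x = (if x = \<delta> then 1 else 0)"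
    using VW.linear_independent_extend[OF ind, of "\<lambda>x. if x = \<delta> then 1 else 0"] by blast
  interpret L: Vector_Spaces.linear ?s "(*)" \<Lambda> by (rule lin)
  have "\<Lambda> b = 0" if "b \<in> B" for b
    using \<Lambda> that B(1) \<delta> by auto
  then have "\<Lambda> f = 0" if "f \<in> U" for f
    using L.eq_0_on_span[of B f] that span by blast
  then show thesis
    using \<Lambda> by (intro that[of \<Lambda>] L.add) auto
qed

section \<open>Extending partial automorphisms of finite elementary abelian groups\<close>

lemma elementary_swap:
  fixes c :: "'b :: ab_group_add"
  assumes "c + c = 0"
  shows "c + x + (c + y) = x + y" "c + x + y = c + (x + y)" "x + (c + y) = c + (x + y)"
proof -
  have "c + x + (c + y) = (c + c) + (x + y)" by (simp only: ac_simps)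
  then show "c + x + (c + y) = x + y" by (simp add: assms)
qed (simp_all only: ac_simps)

lemma exists_finite_subgroup:
  fixes T :: "'b :: ab_group_add set"
  assumes "finite T" and two: "\<And>x :: 'b. x + x = 0"
  obtains W where "finite W" "T \<subseteq> W" "0 \<in> W" "\<And>x y. x \<in> W \<Longrightarrow> y \<in> W \<Longrightarrow> x + y \<in> W"
proof -
  have "\<exists>W. finite W \<and> T \<subseteq> W \<and> 0 \<in> W \<and> (\<forall>x\<in>W. \<forall>y\<in>W. x + y \<in> W)"
    using assms(1)
  proof induction
    case empty
    show ?case by (rule exI[of _ "{0}"]) auto
  next
    case (insert t T)
    then obtain W where W: "finite W" "T \<subseteq> W" "0 \<in> W" "\<And>x y. x \<in> W \<Longrightarrow> y \<in> W \<Longrightarrow> x + y \<in> W"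
      by blast
    have "x + y \<in> W \<union> (+) t ` W" if xy: "x \<in> W \<union> (+) t ` W" "y \<in> W \<union> (+) t ` W" for x y
    proof -
      obtain x' where "x' \<in> W" "x = x' \<or> x = t + x'"
        using xy(1) by blast
      moreover obtain y' where "y' \<in> W" "y = y' \<or> y = t + y'"
        using xy(2) by blast
      ultimately have "x' + y' \<in> W" "x + y = x' + y' \<or> x + y = t + (x' + y')"
        using W(4) elementary_swap[OF two, of t x' y'] by auto
      then show ?thesis by auto
    qed
    moreover have "t \<in> (+) t ` W"
      using W(3) by (auto intro: image_eqI[of _ _ 0])
    ultimately show ?case
      using W by (intro exI[of _ "W \<union> (+) t ` W"]) auto
  qed
  then show thesis using that by blast
qed

text \<open>By injectivity \<open>U\<close> and its image have the same size, so while
  \<open>U\<close> is not all of \<open>W\<close> there are \<open>a\<close> outside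
  \<open>U\<close> and \<open>b\<close> outside the image. Sending \<open>a\<close> to
  \<open>b\<close> extends \<open>g\<close> to a domain twice as large.\<close>

lemma extend_partial_automorphism:
  fixes W :: "'b :: ab_group_add set"
  assumes two: "\<And>x :: 'b. x + x = 0"
    and W: "finite W" "0 \<in> W" "\<And>x y. x \<in> W \<Longrightarrow> y \<in> W \<Longrightarrow> x + y \<in> W"
    and U: "U \<subseteq> W" "0 \<in> U" "\<And>x y. x \<in> U \<Longrightarrow> y \<in> U \<Longrightarrow> x + y \<in> U"
    and g: "g ` U \<subseteq> W" "inj_on g U" "\<And>x y. x \<in> U \<Longrightarrow> y \<in> U \<Longrightarrow> g (x + y) = g x + g y"
  obtains h where "bij_betw h W W" "\<And>x y. x \<in> W \<Longrightarrow> y \<in> W \<Longrightarrow> h (x + y) = h x + h y"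
    "\<And>x. x \<in> U \<Longrightarrow> h x = g x"
proof -
  have "\<exists>h. bij_betw h W W \<and> (\<forall>x\<in>W. \<forall>y\<in>W. h (x + y) = h x + h y) \<and> (\<forall>x\<in>U. h x = g x)"
    using U g
  proof (induction "card W - card U" arbitrary: U g rule: less_induct)
    case less
    note U = less.prems(1-3) and g = less.prems(4-6)
    have aa: "a + (a + x) = x" for a x :: 'b
      using two[of a] by (simp flip: add.assoc)
    show ?case
    proof (cases "U = W")
      case True
      then have "bij_betw g W W"
        using g W by (auto simp: bij_betw_def endo_inj_surj)
      then show ?thesis using g True by auto
    next
      case False
      then obtain a where a: "a \<in> W" "a \<notin> U" using U by auto
      have cU: "card U < card W"
        using False U W by (simp add: psubset_card_mono psubset_eq)
      have "g ` U \<noteq> W"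
        using cU card_image[OF g(2)] by auto
      then obtain b where b: "b \<in> W" "b \<notin> g ` U" using g by auto
      define U' where "U' = U \<union> (+) a ` U"
      define g' where "g' x = (if x \<in> U then g x else b + g (a + x))" for x
      have nU: "a + x \<notin> U" if "x \<in> U" for x
      proof
        assume "a + x \<in> U"
        then have "x + (a + x) \<in> U" using that U by blast
        then show False using a aa[of x a] by (metis add.commute)
      qed
      have g'1: "g' x = g x" and g'2: "g' (a + x) = b + g x" if "x \<in> U" for x
        using that nU by (auto simp: g'_def aa)
      have U': "U' \<subseteq> W" "0 \<in> U'"
        using U W a by (auto simp: U'_def)
      have UU: "U \<subseteq> U'" and aU: "a \<in> U'"
        using U(2) by (auto simp: U'_def intro: image_eqI[of _ _ 0])
      have split: "\<exists>x'\<in>U. x = x' \<or> x = a + x'" if "x \<in> U'" for x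
        using that by (auto simp: U'_def)
      have closed_add': "x + y \<in> U' \<and> g' (x + y) = g' x + g' y" if xy: "x \<in> U'" "y \<in> U'" for x y
      proof -
        obtain x' y' where x': "x' \<in> U" "x = x' \<or> x = a + x'" and y': "y' \<in> U" "y = y' \<or> y = a + y'"
          using split[OF xy(1)] split[OF xy(2)] by blast
        have U_sum: "x' + y' \<in> U" using x' y' U by blast
        then have in': "x' + y' \<in> U'" "a + (x' + y') \<in> U'"
          by (auto simp: U'_def)
        define z where "z = x' + y'"
        define k where "k = g x' + g y'"
        have sums: "x' + y' = z" "a + x' + (a + y') = z" "a + x' + y' = a + z" "x' + (a + y') = a + z"
          "g x' + g y' = k" "b + g x' + (b + g y') = k" "b + g x' + g y' = b + k" "g x' + (b + g y') = b + k"
          unfolding z_def k_def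
          using elementary_swap[OF two, of a x' y'] elementary_swap[OF two, of b "g x'" "g y'"] by auto
        note g'_simps = g'1[OF x'(1)] g'1[OF y'(1)] g'1[OF U_sum] g'2[OF x'(1)] g'2[OF y'(1)]
          g'2[OF U_sum] g(3)[OF x'(1) y'(1)]
        show ?thesis
          using x'(2) y'(2) by (elim disjE; simp only: sums g'_simps[unfolded sums] in'[unfolded sums] simp_thms)
      qed
      then have closed': "x + y \<in> U'" and add': "g' (x + y) = g' x + g' y"
        if "x \<in> U'" "y \<in> U'" for x y
        using that by blast+
      have im': "g' ` U' \<subseteq> W"
        using g(1) b W(3) unfolding U'_def by (auto simp: g'1 g'2)
      have neq: "b + g x \<noteq> g y" if "x \<in> U" "y \<in> U" for x y
      proof
        assume "b + g x = g y"
        then have "b = g x + g y"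
          using aa[of "g x" b] by (simp add: add.commute)
        then show False using b(2) g(3)[OF that] U(3)[OF that] by (metis image_eqI)
      qed
      have inj': "inj_on g' U'"
      proof (rule inj_onI)
        fix x y assume "x \<in> U'" "y \<in> U'" "g' x = g' y"
        then show "x = y"
          unfolding U'_def using g(2) neq neq[symmetric] by (auto simp: g'1 g'2 dest: inj_onD)
      qed
      have "card U < card U'"
        using U' UU aU a W(1) by (intro psubset_card_mono) (auto dest: finite_subset)
      then have "card W - card U' < card W - card U"
        using cU by linarith
      then obtain h where "bij_betw h W W" "\<forall>x\<in>W. \<forall>y\<in>W. h (x + y) = h x + h y" "\<forall>x\<in>U'. h x = g' x"
        using less.hyps[of U' g'] U' closed' im' inj' add' by blast
      then show ?thesis
        using UU g'1 by (intro exI[of _ h]) auto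
    qed
  qed
  then show thesis using that by blast
qed

section \<open>Functions on the tree orthogonal to all edges\<close>

text \<open>The edge from \<open>u\<close> to \<open>x u\<close> is encoded as \<open>(u, x)\<close>. On the path from \<open>u\<close> to
  \<open>v u\<close>, which reads \<open>v\<close> from the right, the letter \<open>v ! j\<close> traverses the edge based at
  \<open>word_act (suffix_at v j) u\<close>, forwards or backwards according to its sign.\<close>

definition suffix_at :: "'a word \<Rightarrow> nat \<Rightarrow> 'a word" where
  "suffix_at v j = (if snd (v ! j) then drop (Suc j) v else drop j v)"

definition tree_edge :: "'a \<times> bool \<Rightarrow> 'a word \<Rightarrow> 'a word \<times> 'a" where
  "tree_edge p u = (if snd p then u else letter_act p u, fst p)"

text \<open>For reduced \<open>u\<close> this tells whether the path from \<open>[]\<close> to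
  \<open>u\<close> crosses \<open>e\<close>: it is the indicator of the half-tree that
  \<open>e\<close> cuts off from the root.\<close>

primrec crossings :: "'a word \<times> 'a \<Rightarrow> 'a word \<Rightarrow> bit" where
  "crossings e [] = 0"
| "crossings e (p # u) = crossings e u + of_bool (tree_edge p u = e)"

lemma tree_edge_inv:
  assumes "u \<in> reduced_words A"
  shows "tree_edge (letter_inv p) (letter_act p u) = tree_edge p u"
  using letter_act_inv[OF assms, of p] by (cases p; cases "snd p") (simp_all add: tree_edge_def letter_inv_def)

text \<open>If \<open>p\<close> cancels, the step goes back over the edge crossed last, and counting
  that edge twice gives zero modulo 2.\<close>

lemma crossings_letter_act:
  assumes u: "u \<in> reduced_words A"
  shows "crossings e (letter_act p u) = crossings e u + of_bool (tree_edge p u = e)"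
proof (cases "u \<noteq> [] \<and> cancels p (hd u)")
  case True
  then obtain u' where u': "u = letter_inv p # u'"
    by (cases u) (auto simp: cancels_iff)
  then have "letter_act p u = u'"
    by (simp add: letter_act_def cancels_iff)
  then have "tree_edge (letter_inv p) u' = tree_edge p u"
    using tree_edge_inv[OF u, of p] by simp
  then show ?thesis
    using \<open>letter_act p u = u'\<close> by (simp add: u' add.assoc)
qed (auto simp: letter_act_def)

lemma crossings_word_act:
  assumes u: "u \<in> reduced_words A" "fst ` set v \<subseteq> A"
  shows "crossings e (word_act v u) + crossings e u =
    (\<Sum>j<length v. of_bool (tree_edge (v ! j) (word_act (drop (Suc j) v) u) = e))"
  using u(2)
proof (induction v)
  case (Cons p v)
  have "word_act v u \<in> reduced_words A"
    using Cons.prems by (intro word_act_closed[OF u(1)]) auto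
  then have "crossings e (word_act (p # v) u) + crossings e u =
      of_bool (tree_edge p (word_act v u) = e) + (crossings e (word_act v u) + crossings e u)"
    by (simp add: crossings_letter_act algebra_simps)
  also have "\<dots> = (\<Sum>j<length (p # v). of_bool (tree_edge ((p # v) ! j) (word_act (drop (Suc j) (p # v)) u) = e))"
    using Cons by (simp add: sum.lessThan_Suc_shift del: sum.lessThan_Suc)
  finally show ?case .
qed simp

lemma almost_invariant_add:
  fixes f g :: "'a word \<Rightarrow> bit"
  assumes "almost_invariant A f" "almost_invariant A g"
  shows "almost_invariant A (f + g)"
  unfolding almost_invariant_def
  by (rule finite_subset[OF _ finite_UnI[OF assms[unfolded almost_invariant_def]]]) auto

lemma almost_invariant_crossings: "almost_invariant A (crossings (h, x))"
  unfolding almost_invariant_def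
proof (rule finite_subset)
  show "{(p, u). fst p \<in> A \<and> u \<in> reduced_words A \<and>
      crossings (h, x) (letter_act p u) \<noteq> crossings (h, x) u} \<subseteq>
    {((x, True), h), ((x, False), letter_act (x, True) h)}"
  proof (intro subsetI, elim CollectE case_prodE conjE, hypsubst)
    fix p u assume u: "u \<in> reduced_words A" and
      ne: "crossings (h, x) (letter_act p u) \<noteq> crossings (h, x) u"
    have "tree_edge p u = (h, x)"
      using ne u by (cases "tree_edge p u = (h, x)") (simp_all add: crossings_letter_act)
    then show "(p, u) \<in> {((x, True), h), ((x, False), letter_act (x, True) h)}"
      using letter_act_inv[OF u, of "(x, False)"]
      by (cases p; cases "snd p") (auto simp: tree_edge_def letter_inv_def)
  qed
qed simp

text \<open>By hypothesis the point mass at \<open>[]\<close> is not the change under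
  \<open>v\<close> of an almost invariant function, so a functional kills all such changes but not
  this point mass; \<open>\<phi>\<close> lists its values on point masses. The relation for
  \<open>h\<close> and \<open>x\<close> is its vanishing on the change of the half-tree bounded by
  the edge \<open>(h, x)\<close>.\<close>

lemma exists_orthogonal_function:
  fixes v :: "'a word"
  defines "A \<equiv> fst ` set v"
  assumes no: "\<not> (\<exists>f :: 'a word \<Rightarrow> bit. almost_invariant A f \<and>
      (\<forall>u\<in>reduced_words A. f (word_act v u) + f u = of_bool (u = [])))"
  obtains \<phi> :: "'a word \<Rightarrow> bit" where "\<phi> [] = 1" "\<And>h. h \<notin> reduced_words A \<Longrightarrow> \<phi> h = 0"
    "\<And>h x. h \<in> reduced_words A \<Longrightarrow>
      (\<Sum>j<length v. if fst (v ! j) = x then \<phi> (word_act (word_inv (suffix_at v j)) h) else 0) = 0"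
proof -
  let ?R = "reduced_words A"
  define U :: "('a word \<Rightarrow> bit) set" where
    "U = {F. \<exists>f. almost_invariant A f \<and> (\<forall>u\<in>?R. f (word_act v u) + f u = F u)}"
  define \<delta> :: "'a word \<Rightarrow> 'a word \<Rightarrow> bit" where "\<delta> u = (\<lambda>u'. of_bool (u' = u))" for u
  obtain \<Lambda> :: "('a word \<Rightarrow> bit) \<Rightarrow> bit" where \<Lambda>: "\<And>f g. \<Lambda> (f + g) = \<Lambda> f + \<Lambda> g"
    "\<And>f. f \<in> U \<Longrightarrow> \<Lambda> f = 0" "\<Lambda> (\<delta> []) = 1"
  proof (rule exists_functional)
    show "0 \<in> U"
      unfolding U_def by (auto intro!: exI[of _ "0 :: 'a word \<Rightarrow> bit"] simp: almost_invariant_def)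
    show "F + F' \<in> U" if F: "F \<in> U" "F' \<in> U" for F F'
    proof -
      obtain f f' where "almost_invariant A f" "\<forall>u\<in>?R. f (word_act v u) + f u = F u"
        "almost_invariant A f'" "\<forall>u\<in>?R. f' (word_act v u) + f' u = F' u"
        using F unfolding U_def by blast
      note f = this
      have "(f + f') (word_act v u) + (f + f') u = (F + F') u" if "u \<in> ?R" for u
      proof -
        have "(F + F') u = f (word_act v u) + f u + (f' (word_act v u) + f' u)"
          using f(2,4) that by simp
        then show ?thesis by (simp add: ac_simps)
      qed
      then show ?thesis
        unfolding U_def mem_Collect_eq
        by (intro exI[of _ "f + f'"] conjI almost_invariant_add[OF f(1,3)] ballI)
    qed
    show "\<delta> [] \<notin> U"
      using no by (auto simp: U_def \<delta>_def)
  qed blast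
  have \<Lambda>0: "\<Lambda> 0 = 0" using \<Lambda>(1)[of 0 0] by simp
  have \<Lambda>sum: "\<Lambda> (\<Sum>i\<in>I. F i) = (\<Sum>i\<in>I. \<Lambda> (F i))" for F and I :: "nat set"
    by (induction I rule: infinite_finite_induct) (simp_all only: sum.insert sum.empty sum.infinite \<Lambda>(1) \<Lambda>0 not_False_eq_True)
  define \<phi> where "\<phi> h = (if h \<in> ?R then \<Lambda> (\<delta> h) else 0)" for h
  have sA: "fst ` set (suffix_at v j) \<subseteq> A" for j
    unfolding suffix_at_def A_def using set_drop_subset by (auto dest: in_set_dropD)
  have "(\<Sum>j<length v. if fst (v ! j) = x then \<phi> (word_act (word_inv (suffix_at v j)) h) else 0) = 0"
    if h: "h \<in> ?R" for h x
  proof -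
    let ?F = "\<Sum>j<length v. if fst (v ! j) = x then \<delta> (word_act (word_inv (suffix_at v j)) h) else 0"
    \<comment> \<open>Solving for the \<open>u\<close> at which step \<open>j\<close> of the path
      from \<open>u\<close> to \<open>v u\<close> crosses \<open>(h, x)\<close> gives one point mass
      for each occurrence of \<open>x\<close> in \<open>v\<close>.\<close>
    have "crossings (h, x) (word_act v u) + crossings (h, x) u = ?F u" if u: "u \<in> ?R" for u
    proof -
      have "of_bool (tree_edge (v ! j) (word_act (drop (Suc j) v) u) = (h, x)) =
          (if fst (v ! j) = x then \<delta> (word_act (word_inv (suffix_at v j)) h) else 0) u"
        if j: "j < length v" for j
      proof -
        have "tree_edge (v ! j) (word_act (drop (Suc j) v) u) = (word_act (suffix_at v j) u, fst (v ! j))"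
          using j by (simp add: tree_edge_def suffix_at_def flip: Cons_nth_drop_Suc)
        moreover have "word_act (suffix_at v j) u = h \<longleftrightarrow> u = word_act (word_inv (suffix_at v j)) h"
          using word_act_inv[OF u, of "suffix_at v j"] word_act_inv[OF h, of "word_inv (suffix_at v j)"]
          by auto
        ultimately show ?thesis by (auto simp: \<delta>_def)
      qed
      then show ?thesis
        unfolding crossings_word_act[OF u equalityD2[OF meta_eq_to_obj_eq[OF A_def]]] sum_fun_apply
        by (intro sum.cong[OF refl]) blast
    qed
    then have "?F \<in> U"
      unfolding U_def mem_Collect_eq
      by (intro exI[of _ "crossings (h, x)"] conjI ballI almost_invariant_crossings)
    then have "\<Lambda> ?F = 0" by (rule \<Lambda>)
    moreover have "\<Lambda> (if c then \<delta> (word_act (word_inv (suffix_at v j)) h) else 0) =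
        (if c then \<phi> (word_act (word_inv (suffix_at v j)) h) else 0)" for j c
      using word_act_closed[OF h, of "word_inv (suffix_at v j)"] sA by (simp add: \<phi>_def \<Lambda>0)
    ultimately show ?thesis by (simp add: \<Lambda>sum)
  qed
  then show thesis
    using \<Lambda>(3) by (intro that[of \<phi>]) (auto simp: \<phi>_def)
qed

section \<open>Actions on finite sets\<close>

lemma finite_Bij: "finite S \<Longrightarrow> finite (Bij S)"
  by (rule finite_subset[of _ "S \<rightarrow>\<^sub>E S"]) (auto simp: Bij_def bij_betw_def PiE_def intro: finite_PiE[unfolded PiE_def])

locale permutation_action = group G for G (structure) +
  fixes S :: "'s set" and \<theta> :: "'a \<Rightarrow> 's \<Rightarrow> 's"
  assumes hom: "\<theta> \<in> hom G (BijGroup S)"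
begin

lemma Bij: "g \<in> carrier G \<Longrightarrow> \<theta> g \<in> Bij S"
  using hom_in_carrier[OF hom] by (simp add: BijGroup_def)

lemma closed: "g \<in> carrier G \<Longrightarrow> x \<in> S \<Longrightarrow> \<theta> g x \<in> S"
  using Bij[of g] by (auto simp: Bij_def bij_betw_def)

lemma mult: "g \<in> carrier G \<Longrightarrow> h \<in> carrier G \<Longrightarrow> x \<in> S \<Longrightarrow> \<theta> (g \<otimes> h) x = \<theta> g (\<theta> h x)"
  using hom_mult[OF hom, of g h] Bij by (simp add: BijGroup_def compose_eq)

lemma one: "x \<in> S \<Longrightarrow> \<theta> \<one> x = x"
  using hom_one[OF hom is_group group_BijGroup] by (simp add: BijGroup_def)

lemma inv_act:
  assumes "g \<in> carrier G" "x \<in> S"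
  shows "\<theta> (inv g) (\<theta> g x) = x" "\<theta> g (\<theta> (inv g) x) = x"
  using assms mult[of "inv g" g x] mult[of g "inv g" x] one by simp_all

end

section \<open>Separating a word from the primitive elements\<close>

text \<open>Leaving \<open>F\<close> unchanged off the tree makes the shift a bijection on all functions.\<close>

definition letter_shift :: "'a set \<Rightarrow> 'a \<times> bool \<Rightarrow> ('a word \<Rightarrow> bit) \<Rightarrow> 'a word \<Rightarrow> bit" where
  "letter_shift A p F h = (if h \<in> reduced_words A then F (letter_act (letter_inv p) h) else F h)"

lemma letter_shift_inv:
  assumes "fst p \<in> A"
  shows "letter_shift A (letter_inv p) (letter_shift A p F) = F"
  using assms letter_act_closed[of _ A p] by (auto simp: letter_shift_def fun_eq_iff letter_act_inv)

lemma letter_shift_add: "letter_shift A p (F + F') = letter_shift A p F + letter_shift A p F'"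
  by (auto simp: letter_shift_def fun_eq_iff)

lemma foldr_letter_shift:
  assumes "fst ` set u \<subseteq> A"
  shows "foldr (letter_shift A) u F h = (if h \<in> reduced_words A then F (word_act (word_inv u) h) else F h)"
  using assms
proof (induction u arbitrary: h)
  case (Cons p u)
  then show ?case
    using letter_act_closed[of h A "letter_inv p"] by (auto simp: letter_shift_def)
qed simp

text \<open>The linear form of M. Hall's argument: a letter is a partial automorphism of
  \<open>W\<close>, defined where the shift stays in \<open>W\<close>, and any extension to
  \<open>W\<close> keeps all shifts between members of \<open>T\<close>.\<close>

lemma exists_linear_shifts:
  fixes A :: "'a set" and T :: "('a word \<Rightarrow> bit) set"
  assumes "finite T"
  obtains W h where "finite W" "T \<subseteq> W" "0 \<in> W" "\<And>F F'. F \<in> W \<Longrightarrow> F' \<in> W \<Longrightarrow> F + F' \<in> W"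
    "\<And>x. bij_betw (h x) W W" "\<And>x F F'. F \<in> W \<Longrightarrow> F' \<in> W \<Longrightarrow> h x (F + F') = h x F + h x F'"
    "\<And>x F. x \<in> A \<Longrightarrow> F \<in> W \<Longrightarrow> letter_shift A (x, True) F \<in> W \<Longrightarrow> h x F = letter_shift A (x, True) F"
proof -
  obtain W where W: "finite W" "T \<subseteq> W" "0 \<in> W" "\<And>F F'. F \<in> W \<Longrightarrow> F' \<in> W \<Longrightarrow> F + F' \<in> W"
    using exists_finite_subgroup[OF assms] bit_fun_add_self by blast
  have "\<exists>k. bij_betw k W W \<and> (\<forall>F\<in>W. \<forall>F'\<in>W. k (F + F') = k F + k F') \<and>
      (x \<in> A \<longrightarrow> (\<forall>F\<in>W. letter_shift A (x, True) F \<in> W \<longrightarrow> k F = letter_shift A (x, True) F))" for x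
  proof (cases "x \<in> A")
    case True
    let ?g = "letter_shift A (x, True)"
    let ?U = "{F \<in> W. ?g F \<in> W}"
    have zero: "?g 0 = 0" by (auto simp: letter_shift_def fun_eq_iff)
    have inj: "inj_on ?g ?U"
      by (rule inj_on_inverseI[of _ "letter_shift A (letter_inv (x, True))"])
         (simp add: letter_shift_inv True)
    obtain k where "bij_betw k W W" "\<And>F F'. F \<in> W \<Longrightarrow> F' \<in> W \<Longrightarrow> k (F + F') = k F + k F'"
      "\<And>F. F \<in> ?U \<Longrightarrow> k F = ?g F"
      by (rule extend_partial_automorphism[of W ?U ?g])
         (use W inj zero in \<open>auto simp: letter_shift_add\<close>)
    then show ?thesis by (intro exI[of _ k]) auto
  qed (auto intro!: exI[of _ id])
  then obtain h where "\<And>x. bij_betw (h x) W W \<and> (\<forall>F\<in>W. \<forall>F'\<in>W. h x (F + F') = h x F + h x F') \<and>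
      (x \<in> A \<longrightarrow> (\<forall>F\<in>W. letter_shift A (x, True) F \<in> W \<longrightarrow> h x F = letter_shift A (x, True) F))"
    by metis
  then show thesis using W that[of W h] by blast
qed

lemma (in group) additive_action:
  fixes W :: "('w :: plus) set"
  assumes "permutation_action G W \<rho>" and X: "X \<subseteq> carrier G" "generate G X = carrier G"
    and W: "\<And>F F'. F \<in> W \<Longrightarrow> F' \<in> W \<Longrightarrow> F + F' \<in> W"
    and add: "\<And>x F F'. x \<in> X \<Longrightarrow> F \<in> W \<Longrightarrow> F' \<in> W \<Longrightarrow> \<rho> x (F + F') = \<rho> x F + \<rho> x F'"
    and g: "g \<in> carrier G" "F \<in> W" "F' \<in> W"
  shows "\<rho> g (F + F') = \<rho> g F + \<rho> g F'"
proof -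
  interpret R: permutation_action G W \<rho> by fact
  let ?H = "{g \<in> carrier G. \<forall>F\<in>W. \<forall>F'\<in>W. \<rho> g (F + F') = \<rho> g F + \<rho> g F'}"
  have "subgroup ?H G"
  proof
    show "a \<otimes> b \<in> ?H" if "a \<in> ?H" "b \<in> ?H" for a b
      using that W by (auto simp: R.mult R.closed)
    show "inv a \<in> ?H" if a: "a \<in> ?H" for a
    proof -
      have "\<rho> (inv a) (F + F') = \<rho> (inv a) F + \<rho> (inv a) F'" if F: "F \<in> W" "F' \<in> W" for F F'
      proof -
        have in_W: "\<rho> (inv a) F \<in> W" "\<rho> (inv a) F' \<in> W" using a F by (auto intro: R.closed)
        then have "\<rho> a (\<rho> (inv a) F + \<rho> (inv a) F') = F + F'"
          using a F by (simp add: R.inv_act)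
        then show ?thesis
          using R.inv_act(1)[of a "\<rho> (inv a) F + \<rho> (inv a) F'"] a in_W W by simp
      qed
      then show ?thesis using a by auto
    qed
  qed (auto simp: R.one W)
  then have "generate G X \<subseteq> ?H"
    by (intro generate_subgroup_incl) (use X add in auto)
  then show ?thesis using g X by auto
qed

text \<open>Maps sending \<open>(f, t)\<close> to \<open>(\<rho> g f, t + d g f)\<close> turn a
  derivation \<open>d\<close> into the dual of \<open>W\<close> into a homomorphism to the
  permutations of a finite set that does not depend on \<open>p\<close>. At \<open>\<phi>\<close>,
  the functional \<open>d p\<close> can be given the value 1, while \<open>orth\<close> makes the
  functional at the word vanish.\<close>

lemma (in group) separate_from_primitive:
  fixes \<phi> :: "'a word \<Rightarrow> bit"
  assumes B: "free_basis G B" and v: "fst ` set v \<subseteq> B" and A: "A = fst ` set v"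
    and \<phi>: "\<phi> [] = 1" "\<And>h. h \<notin> reduced_words A \<Longrightarrow> \<phi> h = 0"
    and orth: "\<And>h x. h \<in> reduced_words A \<Longrightarrow>
      (\<Sum>j<length v. if fst (v ! j) = x then \<phi> (word_act (word_inv (suffix_at v j)) h) else 0) = 0"
  shows "\<exists>K :: (('a word \<Rightarrow> bit) \<times> bit \<Rightarrow> ('a word \<Rightarrow> bit) \<times> bit) monoid.
    group K \<and> finite (carrier K) \<and>
    (\<forall>p. primitive G p \<longrightarrow> (\<exists>\<theta>\<in>hom G K. \<theta> p \<noteq> \<theta> (word_eval G v)))"
proof -
  let ?n = "length v"
  have BG: "B \<subseteq> carrier G" "generate G B = carrier G"
    using B by (auto simp: free_basis_def)
  \<comment> \<open>These translates of \<open>\<phi>\<close> by suffixes of \<open>v\<close> are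
    the only functions that \<open>W\<close> has to shift faithfully.\<close>
  define F where "F j = foldr (letter_shift A) (drop j v) \<phi>" for j
  obtain W h where W: "finite W" "F ` {..?n} \<subseteq> W" "0 \<in> W" "\<And>F F'. F \<in> W \<Longrightarrow> F' \<in> W \<Longrightarrow> F + F' \<in> W"
    and h: "\<And>x. bij_betw (h x) W W" "\<And>x F F'. F \<in> W \<Longrightarrow> F' \<in> W \<Longrightarrow> h x (F + F') = h x F + h x F'"
    "\<And>x F. x \<in> A \<Longrightarrow> F \<in> W \<Longrightarrow> letter_shift A (x, True) F \<in> W \<Longrightarrow> h x F = letter_shift A (x, True) F"
    by (rule exists_linear_shifts[of "F ` {..?n}" A]) auto
  have FW: "F j \<in> W" if "j \<le> ?n" for j using W(2) that by auto
  have F_step: "F j = letter_shift A (v ! j) (F (Suc j))" if "j < ?n" for j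
    using that by (simp add: F_def flip: Cons_nth_drop_Suc)
  have "restrict (h x) W \<in> carrier (BijGroup W)" for x
    using h(1)[of x] by (simp add: BijGroup_def Bij_def cong: bij_betw_cong)
  then obtain \<rho> where \<rho>: "\<rho> \<in> hom G (BijGroup W)" "\<And>x. x \<in> B \<Longrightarrow> \<rho> x = restrict (h x) W"
    using free_basis_hom[OF group_axioms group_BijGroup B, of "\<lambda>x. restrict (h x) W" W] by auto
  interpret R: permutation_action G W \<rho> by unfold_locales (rule \<rho>)
  have \<rho>_add: "\<rho> g (F + F') = \<rho> g F + \<rho> g F'" if "g \<in> carrier G" "F \<in> W" "F' \<in> W" for g F F'
    by (rule additive_action[OF R.permutation_action_axioms BG W(4)]) (use that \<rho>(2) h(2) W(4) in auto)
  define S where "S = W \<times> (UNIV :: bit set)"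
  have "finite (UNIV :: bit set)"
    by (rule finite_subset[of _ "{0, 1}"]) (use bit.exhaust in auto)
  then have finS: "finite S"
    unfolding S_def using W(1) by (intro finite_cartesian_product)
  let ?K = "BijGroup S"
  have "\<exists>\<theta>\<in>hom G ?K. \<theta> p \<noteq> \<theta> (word_eval G v)" if p: "primitive G p" for p
  proof -
    obtain B' where B': "free_basis G B'" "p \<in> B'"
      using p by (auto simp: primitive_def)
    have BG': "B' \<subseteq> carrier G" "generate G B' = carrier G"
      using B' by (auto simp: free_basis_def)
    \<comment> \<open>The derivation to be built is evaluation at \<open>[]\<close> on
      \<open>p\<close> and zero on the rest of \<open>B'\<close>.\<close>
    define \<theta>0 where "\<theta>0 b = (\<lambda>(f, t)\<in>S. (\<rho> b f, t + (if b = p then f [] else 0)))" for b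
    have "\<theta>0 b \<in> carrier ?K" if b: "b \<in> B'" for b
    proof -
      have bG: "b \<in> carrier G" using b BG' by auto
      have "bij_betw (\<lambda>(f, t). (\<rho> b f, t + (if b = p then f [] else 0))) S S"
        \<comment> \<open>The inverse has to evaluate the function as it was before \<open>b\<close>
          moved it.\<close>
        by (rule bij_betw_byWitness[where f' = "\<lambda>(f, t). (\<rho> (inv b) f, t + (if b = p then \<rho> (inv b) f [] else 0))"])
           (use bG in \<open>auto simp: S_def R.inv_act R.closed add.assoc\<close>)
      then show ?thesis
        unfolding \<theta>0_def BijGroup_def Bij_def by (simp cong: bij_betw_cong)
    qed
    then obtain \<theta> where \<theta>: "\<theta> \<in> hom G ?K" "\<And>b. b \<in> B' \<Longrightarrow> \<theta> b = \<theta>0 b"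
      using free_basis_hom[OF group_axioms group_BijGroup B'(1), of \<theta>0 S] by auto
    interpret T: permutation_action G S \<theta> by unfold_locales (rule \<theta>)
    define d where "d g f = snd (\<theta> g (f, 0))" for g f
    define cocycle where "cocycle g d \<longleftrightarrow> (\<forall>f\<in>W. \<forall>f'\<in>W. d (f + f') = d f + d f') \<and>
      (\<forall>f\<in>W. \<forall>t. \<theta> g (f, t) = (\<rho> g f, t + d f))" for g d
    let ?H = "{g \<in> carrier G. \<exists>d. cocycle g d}"
    have mem_S: "(f, t) \<in> S \<longleftrightarrow> f \<in> W" for f t by (simp add: S_def)
    have "subgroup ?H G"
    proof
      show "\<one> \<in> ?H"
        by (auto simp: cocycle_def T.one R.one mem_S intro!: exI[of _ "\<lambda>_. 0"])
      show "a \<otimes> b \<in> ?H" if ab: "a \<in> ?H" "b \<in> ?H" for a b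
      proof -
        obtain da db where "cocycle a da" "cocycle b db" using ab by auto
        then have "cocycle (a \<otimes> b) (\<lambda>f. db f + da (\<rho> b f))"
          using ab by (auto simp: cocycle_def T.mult R.mult mem_S R.closed \<rho>_add ac_simps)
        moreover have "a \<otimes> b \<in> carrier G" using ab by simp
        ultimately show ?thesis by blast
      qed
      show "inv a \<in> ?H" if a: "a \<in> ?H" for a
      proof -
        obtain da where da: "cocycle a da" using a by auto
        have aG: "a \<in> carrier G" using a by simp
        have "\<theta> (inv a) (f, t) = (\<rho> (inv a) f, t + da (\<rho> (inv a) f))" if f: "f \<in> W" for f t
        proof -
          have in_W: "\<rho> (inv a) f \<in> W" using aG f by (intro R.closed) auto
          then have "\<theta> a (\<rho> (inv a) f, t + da (\<rho> (inv a) f)) = (f, t)"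
            using da f aG in_W by (simp add: cocycle_def R.inv_act add.assoc)
          then show ?thesis
            using T.inv_act(1)[OF aG, of "(\<rho> (inv a) f, t + da (\<rho> (inv a) f))"] in_W by (simp add: mem_S)
        qed
        then have "cocycle (inv a) (\<lambda>f. da (\<rho> (inv a) f))"
          using da aG by (auto simp: cocycle_def \<rho>_add R.closed)
        then show ?thesis using inv_closed[OF aG] by blast
      qed
    qed auto
    moreover have "B' \<subseteq> ?H"
    proof
      fix b assume b: "b \<in> B'"
      have "cocycle b (\<lambda>f. if b = p then f [] else 0)"
        using b by (auto simp: cocycle_def \<theta>(2) \<theta>0_def mem_S)
      then show "b \<in> ?H" using b BG'(1) by blast
    qed
    ultimately have H: "carrier G \<subseteq> ?H"
      using generate_subgroup_incl[of B' ?H] BG' by simp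
    have coc: "cocycle g (d g)" if g: "g \<in> carrier G" for g
    proof -
      obtain d' where d': "cocycle g d'" using H g by auto
      then have "d g f = d' f" if "f \<in> W" for f
        using that d' by (simp add: d_def cocycle_def)
      then show ?thesis using d' W(4) by (auto simp: cocycle_def)
    qed
    have d_add: "d g (f + f') = d g f + d g f'" if "g \<in> carrier G" "f \<in> W" "f' \<in> W" for g f f'
      using coc that unfolding cocycle_def by blast
    have \<theta>_eq: "\<theta> g (f, t) = (\<rho> g f, t + d g f)" if "g \<in> carrier G" "f \<in> W" for g f t
      using coc that unfolding cocycle_def by blast
    have d0: "d g 0 = 0" if "g \<in> carrier G" for g
      using d_add[OF that W(3) W(3)] by simp
    have d_sum: "(\<Sum>i\<in>I. f i) \<in> W \<and> d g (\<Sum>i\<in>I. f i) = (\<Sum>i\<in>I. d g (f i))"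
      if g: "g \<in> carrier G" and f: "\<And>i. i \<in> I \<Longrightarrow> f i \<in> W" for g f and I :: "nat set"
      using f
    proof (induction I rule: infinite_finite_induct)
      case (insert i I)
      then have i: "f i \<in> W" "sum f I \<in> W" "d g (sum f I) = (\<Sum>i\<in>I. d g (f i))" by auto
      show ?case
        unfolding sum.insert[OF insert.hyps(1,2)] d_add[OF g i(1,2)] i(3)
        by (intro conjI W(4) i refl)
    qed (simp_all add: W(3) d0[OF g])
    \<comment> \<open>Fox calculus modulo 2: an occurrence of \<open>x\<close> contributes
      \<open>d x\<close> at the translate by the suffix after it, an occurrence of its inverse at
      the translate by the suffix starting with it.\<close>
    define r where "r j = foldr (letter_shift A) (suffix_at v j) \<phi>" for j
    have r: "r j = (if snd (v ! j) then F (Suc j) else F j)" for j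
      by (simp add: r_def F_def suffix_at_def)
    have rW: "r j \<in> W" if "j < ?n" for j
      using FW that by (simp add: r)
    have letter: "\<theta> (letter_eval G (v ! j)) (F (Suc j), t) = (F j, t + d (fst (v ! j)) (r j))"
      if j: "j < ?n" for j t
    proof -
      obtain x b where xb: "v ! j = (x, b)" by (cases "v ! j")
      have "x \<in> A" using j xb A by (metis fst_conv image_eqI nth_mem)
      then have x: "x \<in> A" "x \<in> B" "x \<in> carrier G" using v BG A by auto
      have in_W: "F j \<in> W" "F (Suc j) \<in> W" using FW j by auto
      show ?thesis
      proof (cases b)
        case True
        have "\<rho> x (F (Suc j)) = F j"
          using h(3)[OF x(1) in_W(2)] in_W F_step[OF j] by (simp add: \<rho>(2) x xb True)
        then show ?thesis
          using \<theta>_eq[OF x(3) in_W(2)] by (simp add: xb True letter_eval_def r)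
      next
        case False
        have inv: "letter_inv (x, False) = (x, True)" by (simp add: letter_inv_def)
        have "letter_shift A (x, True) (F j) = F (Suc j)"
          using letter_shift_inv[of "(x, False)" A "F (Suc j)"] x F_step[OF j] by (simp add: xb False inv)
        then have "\<rho> x (F j) = F (Suc j)"
          using h(3)[OF x(1) in_W(1)] in_W by (simp add: \<rho>(2) x)
        then have "\<theta> x (F j, t + d x (F j)) = (F (Suc j), t)"
          using \<theta>_eq[OF x(3) in_W(1)] by (simp add: add.assoc)
        then show ?thesis
          using T.inv_act(1)[OF x(3), of "(F j, t + d x (F j))"] in_W
          by (simp add: xb False letter_eval_def r mem_S)
      qed
    qed
    have path: "\<theta> (word_eval G (drop (?n - m) v)) (\<phi>, 0) =
        (F (?n - m), \<Sum>i\<in>{?n - m..<?n}. d (fst (v ! i)) (r i))" if "m \<le> ?n" for m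
      using that
    proof (induction m)
      case 0
      have "\<phi> \<in> W" using FW[of ?n] by (simp add: F_def)
      then show ?case by (simp add: T.one mem_S F_def)
    next
      case (Suc m)
      define j where "j = ?n - Suc m"
      have j: "j < ?n" "?n - m = Suc j" using Suc.prems by (auto simp: j_def)
      have dr: "drop j v = v ! j # drop (Suc j) v" using j by (simp add: Cons_nth_drop_Suc)
      have c1: "letter_eval G (v ! j) \<in> carrier G"
        using j(1) v BG(1) by (intro letter_eval_closed) (metis image_eqI nth_mem subsetD)
      have c2: "word_eval G (drop (Suc j) v) \<in> carrier G"
        using v BG(1) image_mono[OF set_drop_subset[of "Suc j" v], of fst]
        by (intro word_eval_closed) (meson subset_trans)
      have "\<phi> \<in> W" using FW[of ?n] by (simp add: F_def)
      then have "\<theta> (word_eval G (drop j v)) (\<phi>, 0) =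
          \<theta> (letter_eval G (v ! j)) (\<theta> (word_eval G (drop (Suc j) v)) (\<phi>, 0))"
        using c1 c2 by (simp add: dr T.mult mem_S)
      also have "\<dots> = (F j, (\<Sum>i\<in>{Suc j..<?n}. d (fst (v ! i)) (r i)) + d (fst (v ! j)) (r j))"
        using Suc j letter[OF j(1)] by simp
      also have "(\<Sum>i\<in>{Suc j..<?n}. d (fst (v ! i)) (r i)) + d (fst (v ! j)) (r j) =
          (\<Sum>i\<in>{j..<?n}. d (fst (v ! i)) (r i))"
        using j by (simp add: sum.atLeast_Suc_lessThan add.commute)
      finally show ?case by (simp add: j_def)
    qed
    \<comment> \<open>Collecting the occurrences of each \<open>x\<close> allows additivity of
      \<open>d x\<close> to be applied to a sum of translates that is zero by
      \<open>orth\<close>.\<close>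
    have "(\<Sum>i\<in>{0..<?n}. d (fst (v ! i)) (r i)) =
        (\<Sum>x\<in>A. \<Sum>i\<in>{i\<in>{0..<?n}. fst (v ! i) = x}. d (fst (v ! i)) (r i))"
      by (rule sum.group[symmetric]) (auto simp: A)
    also have "\<dots> = (\<Sum>x\<in>A. 0)"
    proof (rule sum.cong)
      fix x assume "x \<in> A"
      then have x: "x \<in> carrier G" using A v BG by auto
      let ?I = "{i\<in>{0..<?n}. fst (v ! i) = x}"
      have "(\<Sum>i\<in>?I. r i) = 0"
      proof (rule ext)
        fix u
        have "r i u = (if u \<in> reduced_words A then \<phi> (word_act (word_inv (suffix_at v i)) u) else 0)" for i
          unfolding r_def
          by (subst foldr_letter_shift) (use A \<phi>(2) in \<open>auto simp: suffix_at_def dest: in_set_dropD\<close>)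
        then have "(\<Sum>i\<in>?I. r i) u = (if u \<in> reduced_words A then
            (\<Sum>i\<in>?I. \<phi> (word_act (word_inv (suffix_at v i)) u)) else 0)"
          by (simp add: sum_fun_apply)
        also have "(\<Sum>i\<in>?I. \<phi> (word_act (word_inv (suffix_at v i)) u)) =
            (\<Sum>i<?n. if fst (v ! i) = x then \<phi> (word_act (word_inv (suffix_at v i)) u) else 0)"
          by (rule sum.mono_neutral_cong_left) auto
        finally show "(\<Sum>i\<in>?I. r i) u = 0 u"
          using orth by simp
      qed
      then have "(\<Sum>i\<in>?I. d x (r i)) = 0"
        using d_sum[OF x, of ?I r] rW d0[OF x] by simp
      then show "(\<Sum>i\<in>?I. d (fst (v ! i)) (r i)) = 0" by simp
    qed simp
    finally have "\<theta> (word_eval G v) (\<phi>, 0) = (F 0, 0)"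
      using path[of ?n] by simp
    moreover have "snd (\<theta> p (\<phi>, 0)) = 1"
      using FW[of ?n] B'(2) \<phi>(1) by (simp add: F_def \<theta>(2) \<theta>0_def mem_S)
    ultimately have "\<theta> p \<noteq> \<theta> (word_eval G v)" by auto
    then show ?thesis using \<theta>(1) by blast
  qed
  moreover have "finite (carrier ?K)"
    using finite_Bij[OF finS] by (simp add: BijGroup_def)
  ultimately show ?thesis
    using group_BijGroup by blast
qed

theorem corollary1p5:
  fixes G :: "('a, 'm) monoid_scheme" and k :: nat
  assumes "k \<ge> 1" and "free_group_of_rank G k"
  shows "closedin (profinite_topology G) {g. primitive G g}"
proof -
  obtain X where G: "group G" and X: "finite X" "free_basis G X"
    using assms(2) by (auto simp: free_group_of_rank_def)
  interpret group G by fact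
  show ?thesis
  proof (rule closedin_profinite_topology_if_separated[OF X(2,1)])
    show "{g. primitive G g} \<subseteq> carrier G"
      by (auto simp: primitive_def free_basis_def)
    fix w assume "w \<in> carrier G - {g. primitive G g}"
    then have w: "w \<in> carrier G" "\<not> primitive G w" by auto
    obtain B v where v: "minimal_word G w B v"
      using ex_minimal_word[OF G X(2) w(1)] .
    then have B: "free_basis G B" "fst ` set v \<subseteq> B" "word_eval G v = w"
      by (auto simp: minimal_word_def basis_word_def)
    have "\<not> (\<exists>f :: 'a word \<Rightarrow> bit. almost_invariant (fst ` set v) f \<and>
        (\<forall>u\<in>reduced_words (fst ` set v). f (word_act v u) + f u = of_bool (u = [])))"
    proof (intro notI, elim exE conjE)
      fix f :: "'a word \<Rightarrow> bit"
      assume f: "almost_invariant (fst ` set v) f"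
        "\<forall>u\<in>reduced_words (fst ` set v). f (word_act v u) + f u = of_bool (u = [])"
      \<comment> \<open>This excludes the empty \<open>v\<close>, for which the left-hand side would
        be zero.\<close>
      have f_Nil: "f (word_act v []) + f [] = 1"
        using f(2) by (metis Nil_in_reduced_words of_bool_eq(2))
      then have ne: "v \<noteq> []" by auto
      have cyc: "cyclically_reduced v"
        by (rule minimal_word_cyclically_reduced[OF v])
      then have act_Nil: "word_act v [] = v"
        using word_act_reduced[of v "[]"] cyclically_reduced_imp_reduced by auto
      show False
      proof (rule no_almost_invariant_function[OF ne cyc f(1)])
        show "f (word_act v u) = f u" if "u \<in> reduced_words (fst ` set v)" "u \<noteq> []" for u
        proof -
          have "f (word_act v u) + f u = 0" using f(2) that by simp
          then show ?thesis by (cases "f u"; cases "f (word_act v u)") auto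
        qed
        show "f v \<noteq> f []"
          using f_Nil act_Nil by auto
      qed (fact minimal_word_no_cut_vertex[OF v ne] minimal_word_no_bridge[OF v ne w(2)])+
    qed
    then obtain \<phi> :: "'a word \<Rightarrow> bit" where "\<phi> [] = 1"
      "\<And>h. h \<notin> reduced_words (fst ` set v) \<Longrightarrow> \<phi> h = 0"
      "\<And>h x. h \<in> reduced_words (fst ` set v) \<Longrightarrow>
        (\<Sum>j<length v. if fst (v ! j) = x then \<phi> (word_act (word_inv (suffix_at v j)) h) else 0) = 0"
      using exists_orthogonal_function by blast
    then have "\<exists>K :: (('a word \<Rightarrow> bit) \<times> bit \<Rightarrow> ('a word \<Rightarrow> bit) \<times> bit) monoid.
        group K \<and> finite (carrier K) \<and>
        (\<forall>p. primitive G p \<longrightarrow> (\<exists>\<theta>\<in>hom G K. \<theta> p \<noteq> \<theta> (word_eval G v)))"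
      by (rule separate_from_primitive[OF B(1,2) refl])
    then show "\<exists>K :: (('a word \<Rightarrow> bit) \<times> bit \<Rightarrow> ('a word \<Rightarrow> bit) \<times> bit) monoid.
        group K \<and> finite (carrier K) \<and>
        (\<forall>p\<in>{g. primitive G g}. \<exists>\<theta>\<in>hom G K. \<theta> p \<noteq> \<theta> w)"
      by (simp add: B(3))
  qed
qed

end
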